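(* Let $A\in\bigwedge^pX$ and $B\in\bigwedge^qX$ be nonzero blades. Then $A\vee B=0$ if and only if $[A]+[B]\neq X$. If $A\vee B\neq0$, then $A\vee B$ is the only $(p+q-n)$-blade such that: (i) $[A\vee B]=[A]\cap[B]$; (ii) $\|A\vee B\|=\|A\|\,\|B\|\cos\Theta_{[A]^\perp,[B]}$; (iii) $A\wedge\big((A\vee B)\lrcorner B\big)$ has the orientation of $\Omega$. (That is, $A\vee B$ is a $(p+q-n)$-blade satisfying (i)--(iii), and any $(p+q-n)$-blade $C$ satisfying (i)--(iii) with $C$ in place of $A\vee B$ equals $A\vee B$.)
   Context: $X$ is an $n$-dimensional Euclidean (real) or Hermitian (complex) vector space with inner product $\langle\cdot,\cdot\rangle$, conjugate-linear in the left entry in the complex case. $\bigwedge X=\bigoplus_p\bigwedge^pX$ is its exterior algebra, with inner product given by $\langle v_1\wedge\cdots\wedge v_p,w_1\wedge\cdots\wedge w_p\rangle=\det(\langle v_i,w_j\rangle)$, with distinct $\bigwedge^pX$'s orthogonal, $\langle\kappa,\lambda\rangle=\bar\kappa\lambda$ for scalars, extended (sesqui)linearly; $\|M\|=\sqrt{\langle M,M\rangle}$. Left contraction: for $M,N\in\bigwedge X$, $M\lrcorner N$ is the unique element of $\bigwedge X$ with $\langle L,M\lrcorner N\rangle=\langle M\wedge L,N\rangle$ for all $L\in\bigwedge X$. An orientation of $X$ is a unit element $\Omega\in\bigwedge^nX$; one is fixed. The (right) star is $M^\star=M\lrcorner\Omega$, a bijection of $\bigwedge X$. The regressive product $M\vee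 N$ of $M,N\in\bigwedge X$ is the element of $\bigwedge X$ given by $(M\vee N)^\star=M^\star\wedge N^\star$. A $p$-blade is an element $B=v_1\wedge\cdots\wedge v_p$ with $v_i\in X$ (a $0$-blade is a scalar, and $0$ is a $p$-blade for all $p$). If $B\neq0$ its space is $[B]=\mathrm{span}\{v_1,\dots,v_p\}$; for a scalar $\lambda$, $[\lambda]=\{0\}$. Two nonzero blades $A,B$ have the same orientation if $A=\lambda B$ for some real $\lambda>0$. $P_V$ is the orthogonal projection onto a subspace $V\subset X$, extended to $\bigwedge X$ as an outermorphism (linear, multiplicative for $\wedge$, $P_V(1)=1$). For subspaces $V,W\subset X$, the asymmetric angle is $\Theta_{V,W}=\cos^{-1}\frac{\|P_WC\|}{\|C\|}$, where $C$ is any nonzero blade with $[C]=V$. *)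

theory Defs
  imports
    Complex_Main
    "HOL-Library.Poly_Mapping"
    "HOL-Algebra.QuotRing"
    "Jordan_Normal_Form.Conjugate"
    "Jordan_Normal_Form.Determinant"
begin

section \<open>Scalars\<close>

text \<open>
  The norm law determines \<open>conjugate\<close>, and by the Gelfand-Mazur theorem a real normed field
  is isomorphic to the reals or to the complex numbers.  So, up to isomorphism, this class
  consists of the two instances below.
\<close>

class real_or_complex = real_normed_field + conjugatable_ring +
  assumes conjugate_mult_self: "conjugate x * x = scaleR ((norm x)\<^sup>2) 1"

instance real :: real_or_complex
  by standard (simp add: power2_eq_square)

instance complex :: real_or_complex
proof
  fix x :: complex
  have "conjugate x * x = of_real ((norm x)\<^sup>2)"
    by (simp only: complex_norm_square conjugate_complex_def mult.commute)
  then show "conjugate x * x = (norm x)\<^sup>2 *\<^sub>R 1"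
    by (simp only: of_real_def)
qed


section \<open>Finite-dimensional inner product spaces\<close>

text \<open>The space is the whole type \<open>'v\<close>; only scalar multiplication and inner product are recorded.\<close>

record ('k, 'v) ips =
  scl :: "'k \<Rightarrow> 'v \<Rightarrow> 'v"
  ip :: "'v \<Rightarrow> 'v \<Rightarrow> 'k"

locale fin_inner_space =
  fixes X :: "('k::real_or_complex, 'v::ab_group_add) ips"
  assumes fin_dim: "\<exists>E. finite_dimensional_vector_space (scl X) E"
    and ip_add_right: "ip X x (y + z) = ip X x y + ip X x z"
    and ip_scl_right: "ip X x (scl X c y) = c * ip X x y"
    and ip_conjugate: "ip X y x = conjugate (ip X x y)"
    and ip_pos: "x \<noteq> 0 \<Longrightarrow> \<exists>r::real. 0 < r \<and> ip X x x = of_real r"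

abbreviation ips_dim :: "('k::field, 'v::ab_group_add) ips \<Rightarrow> nat" where
  "ips_dim X \<equiv> vector_space.dim (scl X) UNIV"

abbreviation ips_span :: "('k::field, 'v::ab_group_add) ips \<Rightarrow> 'v set \<Rightarrow> 'v set" where
  "ips_span X S \<equiv> module.span (scl X) S"

definition perp :: "('k::zero, 'v) ips \<Rightarrow> 'v set \<Rightarrow> 'v set" where
  "perp X V = {x. \<forall>v\<in>V. ip X v x = 0}"

definition proj :: "('k::zero, 'v::ab_group_add) ips \<Rightarrow> 'v set \<Rightarrow> 'v \<Rightarrow> 'v" where
  "proj X V x = (THE w. w \<in> V \<and> x - w \<in> perp X V)"


section \<open>The exterior algebra\<close>

text \<open>
  The free monoid on \<open>'v\<close>, written additively because the convolution product of
  \<^theory>\<open>HOL-Library.Poly_Mapping\<close> is taken over an additive monoid.  Thus \<open>'v tword \<Rightarrow>\<^sub>0 'k\<close> is the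
  free associative \<open>'k\<close>-algebra on the set \<open>'v\<close>.
\<close>

datatype 'v tword = TWord (letters: "'v list")

instantiation tword :: (type) monoid_add
begin
definition zero_tword :: "'a tword" where "zero_tword = TWord []"
definition plus_tword :: "'a tword \<Rightarrow> 'a tword \<Rightarrow> 'a tword" where
  "plus_tword u w = TWord (letters u @ letters w)"
instance by standard (auto simp: zero_tword_def plus_tword_def)
end

definition free_alg :: "('v tword \<Rightarrow>\<^sub>0 'k::comm_ring_1) ring" where
  "free_alg = \<lparr>carrier = UNIV, monoid.mult = (*), one = 1, ring.zero = 0, add = (+)\<rparr>"

lemma free_alg_simps:
  "carrier free_alg = UNIV" "x \<otimes>\<^bsub>free_alg\<^esub> y = x * y" "\<one>\<^bsub>free_alg\<^esub> = 1"
  "\<zero>\<^bsub>free_alg\<^esub> = 0" "x \<oplus>\<^bsub>free_alg\<^esub> y = x + y"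
  by (simp_all add: free_alg_def)

lemma ring_free_alg: "ring (free_alg :: ('v tword \<Rightarrow>\<^sub>0 'k::comm_ring_1) ring)"
proof (rule ringI)
  show "abelian_group (free_alg :: ('v tword \<Rightarrow>\<^sub>0 'k) ring)"
  proof (rule abelian_groupI, unfold free_alg_simps)
    fix x y z :: "'v tword \<Rightarrow>\<^sub>0 'k"
    show "x + y + z = x + (y + z)" by (rule add.assoc)
    show "x + y = y + x" by (rule add.commute)
    show "0 + x = x" by (rule add_0_left)
    show "\<exists>y\<in>UNIV. y + x = 0" using left_minus[of x] by blast
  qed (rule UNIV_I)+
  show "Group.monoid (free_alg :: ('v tword \<Rightarrow>\<^sub>0 'k) ring)"
    by (rule Group.monoidI, unfold free_alg_simps)
      (rule UNIV_I mult.assoc mult_1_left mult_1_right)+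
qed (unfold free_alg_simps, rule distrib_right, rule distrib_left)

abbreviation gen :: "'v \<Rightarrow> ('v tword \<Rightarrow>\<^sub>0 'k::comm_ring_1)" where
  "gen v \<equiv> Poly_Mapping.single (TWord [v]) 1"

abbreviation const :: "'k \<Rightarrow> ('v tword \<Rightarrow>\<^sub>0 'k::comm_ring_1)" where
  "const c \<equiv> Poly_Mapping.single 0 c"

text \<open>
  Dividing the free algebra by the linearity relations gives the tensor algebra of the space;
  dividing that by the squares of vectors gives the exterior algebra.
\<close>

definition ext_ideal :: "('k::real_or_complex, 'v::ab_group_add) ips \<Rightarrow> ('v tword \<Rightarrow>\<^sub>0 'k) set" where
  "ext_ideal X = genideal free_alg
     ({gen (scl X a v + scl X b w) - (const a * gen v + const b * gen w) | a b v w. True}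
      \<union> {gen v * gen v | v. True})"

definition exterior :: "('k::real_or_complex, 'v::ab_group_add) ips \<Rightarrow> ('v tword \<Rightarrow>\<^sub>0 'k) set ring" where
  "exterior X = free_alg Quot (ext_ideal X)"

lemma ring_exterior: "ring (exterior X)"
  unfolding exterior_def ext_ideal_def
  by (rule ideal.quotient_is_ring, rule ring.genideal_ideal, rule ring_free_alg)
    (simp only: free_alg_simps subset_UNIV)

definition ext_class :: "('k::real_or_complex, 'v::ab_group_add) ips \<Rightarrow>
    ('v tword \<Rightarrow>\<^sub>0 'k) \<Rightarrow> ('v tword \<Rightarrow>\<^sub>0 'k) set" where
  "ext_class X x = ext_ideal X +>\<^bsub>free_alg\<^esub> x"

text \<open>The exterior product \<open>M \<and> N\<close> is the ring multiplication of \<^term>\<open>exterior X\<close>.\<close>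

abbreviation wedge :: "('v tword \<Rightarrow>\<^sub>0 'k) set \<Rightarrow> ('k::real_or_complex, 'v::ab_group_add) ips \<Rightarrow>
    ('v tword \<Rightarrow>\<^sub>0 'k) set \<Rightarrow> ('v tword \<Rightarrow>\<^sub>0 'k) set" (\<open>_ \<and>\<^bsub>_\<^esub> _\<close> [71, 0, 70] 70) where
  "M \<and>\<^bsub>X\<^esub> N \<equiv> M \<otimes>\<^bsub>exterior X\<^esub> N"

definition ext_scalar :: "('k::real_or_complex, 'v::ab_group_add) ips \<Rightarrow> 'k \<Rightarrow> ('v tword \<Rightarrow>\<^sub>0 'k) set" where
  "ext_scalar X c = ext_class X (const c)"

definition ext_vec :: "('k::real_or_complex, 'v::ab_group_add) ips \<Rightarrow> 'v \<Rightarrow> ('v tword \<Rightarrow>\<^sub>0 'k) set" where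
  "ext_vec X v = ext_class X (gen v)"

definition ext_scl :: "('k::real_or_complex, 'v::ab_group_add) ips \<Rightarrow> 'k \<Rightarrow>
    ('v tword \<Rightarrow>\<^sub>0 'k) set \<Rightarrow> ('v tword \<Rightarrow>\<^sub>0 'k) set" where
  "ext_scl X c M = ext_scalar X c \<and>\<^bsub>X\<^esub> M"

definition wedge_list :: "('k::real_or_complex, 'v::ab_group_add) ips \<Rightarrow> 'v list \<Rightarrow> ('v tword \<Rightarrow>\<^sub>0 'k) set" where
  "wedge_list X vs = foldr (\<lambda>v M. ext_vec X v \<and>\<^bsub>X\<^esub> M) vs \<one>\<^bsub>exterior X\<^esub>"

text \<open>The \<open>p\<close>-th exterior power is the image of the \<open>p\<close>-fold tensors.\<close>

definition ext_power :: "('k::real_or_complex, 'v::ab_group_add) ips \<Rightarrow> nat \<Rightarrow> ('v tword \<Rightarrow>\<^sub>0 'k) set set" where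
  "ext_power X p = ext_class X ` {x. \<forall>u\<in>Poly_Mapping.keys x. length (letters u) = p}"


subsection \<open>Inner product\<close>

definition gram :: "('k::real_or_complex, 'v) ips \<Rightarrow> 'v list \<Rightarrow> 'v list \<Rightarrow> 'k" where
  "gram X vs ws = (if length vs = length ws
     then det (mat (length vs) (length vs) (\<lambda>(i, j). ip X (vs ! i) (ws ! j))) else 0)"

text \<open>
  The sesquilinear extension of \<^const>\<open>gram\<close> to the free algebra is unaffected by adding elements of
  the ideal, so the value does not depend on the chosen representatives.
\<close>

definition ext_ip :: "('k::real_or_complex, 'v::ab_group_add) ips \<Rightarrow>
    ('v tword \<Rightarrow>\<^sub>0 'k) set \<Rightarrow> ('v tword \<Rightarrow>\<^sub>0 'k) set \<Rightarrow> 'k" where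
  "ext_ip X M N = (let x = (SOME x. x \<in> M); y = (SOME y. y \<in> N) in
     \<Sum>u\<in>Poly_Mapping.keys x. \<Sum>w\<in>Poly_Mapping.keys y.
       conjugate (Poly_Mapping.lookup x u) * Poly_Mapping.lookup y w * gram X (letters u) (letters w))"

text \<open>\<open>\<langle>M, M\<rangle>\<close> is a nonnegative real, so it equals its absolute value, which has type \<^typ>\<open>real\<close>.\<close>

definition ext_norm :: "('k::real_or_complex, 'v::ab_group_add) ips \<Rightarrow> ('v tword \<Rightarrow>\<^sub>0 'k) set \<Rightarrow> real" where
  "ext_norm X M = sqrt (norm (ext_ip X M M))"


section \<open>Contraction, star and regressive product\<close>

definition lcontr :: "('k::real_or_complex, 'v::ab_group_add) ips \<Rightarrow>
    ('v tword \<Rightarrow>\<^sub>0 'k) set \<Rightarrow> ('v tword \<Rightarrow>\<^sub>0 'k) set \<Rightarrow> ('v tword \<Rightarrow>\<^sub>0 'k) set" where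
  "lcontr X M N = (THE K. K \<in> carrier (exterior X) \<and>
     (\<forall>L\<in>carrier (exterior X). ext_ip X L K = ext_ip X (M \<and>\<^bsub>X\<^esub> L) N))"

definition is_orientation :: "('k::real_or_complex, 'v::ab_group_add) ips \<Rightarrow> ('v tword \<Rightarrow>\<^sub>0 'k) set \<Rightarrow> bool" where
  "is_orientation X \<Omega> \<longleftrightarrow> \<Omega> \<in> ext_power X (ips_dim X) \<and> ext_norm X \<Omega> = 1"

definition star :: "('k::real_or_complex, 'v::ab_group_add) ips \<Rightarrow> ('v tword \<Rightarrow>\<^sub>0 'k) set \<Rightarrow>
    ('v tword \<Rightarrow>\<^sub>0 'k) set \<Rightarrow> ('v tword \<Rightarrow>\<^sub>0 'k) set" where
  "star X \<Omega> M = lcontr X M \<Omega>"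

definition regr :: "('k::real_or_complex, 'v::ab_group_add) ips \<Rightarrow> ('v tword \<Rightarrow>\<^sub>0 'k) set \<Rightarrow>
    ('v tword \<Rightarrow>\<^sub>0 'k) set \<Rightarrow> ('v tword \<Rightarrow>\<^sub>0 'k) set \<Rightarrow> ('v tword \<Rightarrow>\<^sub>0 'k) set" where
  "regr X \<Omega> M N = (THE R. R \<in> carrier (exterior X) \<and>
     star X \<Omega> R = star X \<Omega> M \<and>\<^bsub>X\<^esub> star X \<Omega> N)"


section \<open>Blades\<close>

definition is_blade :: "('k::real_or_complex, 'v::ab_group_add) ips \<Rightarrow> nat \<Rightarrow> ('v tword \<Rightarrow>\<^sub>0 'k) set \<Rightarrow> bool" where
  "is_blade X p B \<longleftrightarrow> (if p = 0 then \<exists>c. B = ext_scalar X c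
                       else \<exists>vs. length vs = p \<and> B = wedge_list X vs)"

text \<open>Meaningful for nonzero blades only.\<close>

definition blade_space :: "('k::real_or_complex, 'v::ab_group_add) ips \<Rightarrow> ('v tword \<Rightarrow>\<^sub>0 'k) set \<Rightarrow> 'v set" where
  "blade_space X B = (THE V. (\<exists>vs. vs \<noteq> [] \<and> B = wedge_list X vs \<and> V = ips_span X (set vs))
                           \<or> (\<exists>c. B = ext_scalar X c \<and> V = {0}))"

definition same_orientation :: "('k::real_or_complex, 'v::ab_group_add) ips \<Rightarrow>
    ('v tword \<Rightarrow>\<^sub>0 'k) set \<Rightarrow> ('v tword \<Rightarrow>\<^sub>0 'k) set \<Rightarrow> bool" where
  "same_orientation X A B \<longleftrightarrow> A \<noteq> \<zero>\<^bsub>exterior X\<^esub> \<and> B \<noteq> \<zero>\<^bsub>exterior X\<^esub> \<and>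
     (\<exists>r::real. 0 < r \<and> A = ext_scl X (of_real r) B)"


section \<open>Outermorphisms and the asymmetric angle\<close>

definition outermorphism :: "('k::real_or_complex, 'v::ab_group_add) ips \<Rightarrow>
    (('v tword \<Rightarrow>\<^sub>0 'k) set \<Rightarrow> ('v tword \<Rightarrow>\<^sub>0 'k) set) \<Rightarrow> bool" where
  "outermorphism X F \<longleftrightarrow> F \<in> Ring.ring_hom (exterior X) (exterior X) \<and>
     (\<forall>c. \<forall>M\<in>carrier (exterior X). F (ext_scl X c M) = ext_scl X c (F M))"

text \<open>On the carrier there is exactly one such extension of a linear map.\<close>

definition outer_ext :: "('k::real_or_complex, 'v::ab_group_add) ips \<Rightarrow> ('v \<Rightarrow> 'v) \<Rightarrow>
    ('v tword \<Rightarrow>\<^sub>0 'k) set \<Rightarrow> ('v tword \<Rightarrow>\<^sub>0 'k) set" where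
  "outer_ext X f = (SOME F. outermorphism X F \<and> (\<forall>v. F (ext_vec X v) = ext_vec X (f v)))"

definition asym_angle :: "('k::real_or_complex, 'v::ab_group_add) ips \<Rightarrow> 'v set \<Rightarrow> 'v set \<Rightarrow> real" where
  "asym_angle X V W =
     (let C = (SOME C. (\<exists>p. is_blade X p C) \<and> C \<noteq> \<zero>\<^bsub>exterior X\<^esub> \<and> blade_space X C = V)
      in arccos (ext_norm X (outer_ext X (proj X W) C) / ext_norm X C))"

end

theory Submission
  imports Defs
begin

text \<open>
  Everything is reduced to Gram determinants of orthonormal lists.  A nonzero blade is a scalar times
  the wedge product of an orthonormal basis of its space (\<open>nonzero_blade\<close>).  Complete such a basis
  \<open>as\<close> of \<open>[A]\<close> by \<open>as'\<close> to a basis of the whole space; \<open>\<Omega>\<close> is a phase times the wedge product of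
  \<open>as @ as'\<close>, and the block triangular Gram determinant shows that \<open>A\<^sup>\<star>\<close> is a multiple of the wedge
  product of \<open>as'\<close> (\<open>star_word\<close>).  With \<open>bs @ bs'\<close> chosen likewise for \<open>B\<close>, the product
  \<open>A\<^sup>\<star> \<and> B\<^sup>\<star>\<close> is a nonzero multiple of the wedge product of \<open>as' @ bs'\<close>, whose members span
  \<open>[A]\<^sup>\<bottom> + [B]\<^sup>\<bottom>\<close>.  It vanishes exactly if these vectors are dependent, that is, if
  \<open>[A]\<^sup>\<bottom> \<inter> [B]\<^sup>\<bottom> \<noteq> 0\<close>, that is, if \<open>[A] + [B]\<close> is not the whole space.

  Otherwise \<open>A\<^sup>\<star> \<and> B\<^sup>\<star>\<close> is itself a blade, with space \<open>([A] \<inter> [B])\<^sup>\<bottom>\<close>.  The star is injective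
  (\<open>star_inj\<close>) and takes a suitable multiple of the wedge product of a basis of \<open>[A] \<inter> [B]\<close> to this
  blade, so that multiple is \<open>A \<or> B\<close>; this is (i).  The star preserves the norms of blades, and wedging
  with a basis of \<open>[B]\<^sup>\<bottom>\<close> sees only the projections to \<open>[B]\<close>, so the norm of \<open>A \<or> B\<close> is
  \<open>\<parallel>A\<parallel> \<parallel>B\<parallel>\<close> times the norm of the projection to \<open>[B]\<close> of a unit blade of \<open>[A]\<^sup>\<bottom>\<close>, which is the
  cosine in (ii) (\<open>cos_asym_angle\<close>).  For (iii), adjointness of wedge and contraction gives
  \<open>\<langle>\<Omega>, A \<and> ((A \<or> B) \<lrcorner> B)\<rangle> = \<parallel>A\<^sup>\<star> \<and> B\<^sup>\<star>\<parallel>\<^sup>2 > 0\<close> (\<open>orientation_coefficient\<close>), without any sign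
  computation.

  For uniqueness, a blade with the space in (i) is \<open>\<lambda>\<close> times \<open>A \<or> B\<close>; (ii) forces \<open>\<lambda>\<close> to have modulus
  one, and since the left side of (iii) is conjugate-linear in the blade, (iii) forces \<open>\<lambda>\<close> to be positive.

  The algebraic basis for this is that the wedge products of the sublists of an orthonormal basis are an
  orthonormal basis of the exterior algebra (\<open>fourier_expansion\<close>).  That they span is a sorting
  argument (\<open>gen_mult_subword\<close>); that the inner product is well defined on the quotient is
  \<open>free_ip_ideal_right\<close>.
\<close>

section \<open>Scalars\<close>

lemma conjugate_one [simp]: "conjugate (1::'k::real_or_complex) = 1"
  using conjugate_mult_self[of "1::'k"] by simp

lemma conjugate_mult_self_of_real:
  "conjugate x * x = of_real ((norm (x::'k::real_or_complex))\<^sup>2)"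
  by (simp only: conjugate_mult_self of_real_def)

lemma mult_conjugate_self_of_real:
  "x * conjugate x = of_real ((norm (x::'k::real_or_complex))\<^sup>2)"
  by (subst mult.commute) (rule conjugate_mult_self_of_real)

lemma conjugate_of_real [simp]: "conjugate (of_real r) = (of_real r :: 'k::real_or_complex)"
proof (cases "r = 0")
  case False
  have "conjugate (of_real r) * of_real r = (of_real r * of_real r :: 'k)"
    by (simp add: conjugate_mult_self_of_real power2_eq_square)
  with False show ?thesis by simp
qed simp

lemma norm_conjugate [simp]: "norm (conjugate x) = norm (x::'k::real_or_complex)"
proof (cases "x = 0")
  case False
  have "norm (conjugate x) * norm x = norm (conjugate x * x)"
    by (simp add: norm_mult)
  also have "\<dots> = norm x * norm x"
    by (simp add: conjugate_mult_self_of_real norm_power power2_eq_square norm_mult)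
  finally show ?thesis using False by simp
qed simp

lemma conjugate_comm_ring_hom: "comm_ring_hom (conjugate :: 'k::real_or_complex \<Rightarrow> 'k)"
  by unfold_locales (simp_all add: conjugate_dist_mul conjugate_dist_add)

section \<open>The free algebra\<close>

text \<open>
  Calculations take place in the free algebra, which is a type of class \<open>ring_1\<close> and so has sums,
  signs and induction at hand; \<open>ext_class X\<close> carries the results to the exterior algebra.
  The word of a list represents the wedge product of the list.
\<close>

definition word :: "'v list \<Rightarrow> ('v tword \<Rightarrow>\<^sub>0 'k::comm_ring_1)" where
  "word vs = Poly_Mapping.single (TWord vs) 1"

lemma word_append: "word (us @ vs) = word us * word vs"
  by (simp add: word_def mult_single plus_tword_def)

lemma word_Nil: "word [] = 1"
  by (simp add: word_def zero_tword_def[symmetric])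

lemma gen_eq_word: "gen v = word [v]"
  by (simp add: word_def)

lemma word_Cons: "word (v # vs) = gen v * word vs"
  by (simp add: word_def mult_single plus_tword_def)

lemma const_mult_const: "const c * const d = const (c * d)"
  by (simp add: mult_single)

lemma lookup_const_mult: "Poly_Mapping.lookup (const c * x) u = c * Poly_Mapping.lookup x u"
  for x :: "'v tword \<Rightarrow>\<^sub>0 'k::comm_ring_1"
  by (simp add: mult_map_scale_conv_mult[symmetric] Poly_Mapping.map.rep_eq when_def)

lemma keys_const_mult: "Poly_Mapping.keys (const c * x) \<subseteq> Poly_Mapping.keys x"
  for x :: "'v tword \<Rightarrow>\<^sub>0 'k::comm_ring_1"
  by (auto simp: in_keys_iff lookup_const_mult)

lemma free_alg_induct [case_names zero add]:
  fixes x :: "'v tword \<Rightarrow>\<^sub>0 'k::comm_ring_1"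
  assumes "P 0" "\<And>c vs x. P x \<Longrightarrow> P (const c * word vs + x)"
  shows "P x"
proof (induction x rule: Poly_Mapping.update_induct)
  case const
  show ?case by fact
next
  case (update f a b)
  have "Poly_Mapping.update a b f = const b * word (letters a) + f"
    using update.hyps(1)
    by (auto intro!: poly_mapping_eqI
        simp: Poly_Mapping.lookup_update word_def mult_single lookup_add lookup_single in_keys_iff when_def)
  then show ?case using assms(2)[OF update.IH, of b "letters a"] by simp
qed

lemma const_commute: "const c * x = x * const c"
  for x :: "'v tword \<Rightarrow>\<^sub>0 'k::comm_ring_1"
proof (induction x rule: free_alg_induct)
  case (add d vs x)
  have "const c * (const d * word vs) = const d * word vs * const c"
    by (simp add: word_def mult_single mult.commute)
  with add show ?case by (simp add: distrib_left distrib_right)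
qed simp

text \<open>
  As a rewrite rule this does not terminate when \<open>x\<close> is itself a constant; products of several
  constants are collected by \<open>const_const_mult\<close> and \<open>const_mult_const_mult\<close> instead.
\<close>

lemma const_left_commute: "x * (const c * y) = const c * (x * y)"
  for x y :: "'v tword \<Rightarrow>\<^sub>0 'k::comm_ring_1"
  by (metis const_commute mult.assoc)

lemma const_const_mult: "const a * (const b * x) = const (a * b) * x"
  for x :: "'u tword \<Rightarrow>\<^sub>0 'c::comm_ring_1"
  by (simp only: const_mult_const flip: mult.assoc)

lemma const_mult_const_mult: "(const a * x) * (const b * y) = const (a * b) * (x * y)"
  for x y :: "'u tword \<Rightarrow>\<^sub>0 'c::comm_ring_1"
  by (simp only: mult.assoc const_left_commute[of x b y] const_const_mult)

lemma const_add: "const (c + d) = const c + const d"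
  by (rule single_add)

lemma const_uminus: "const (- c) = - const c"
  by (rule single_uminus)

section \<open>The exterior algebra as a quotient\<close>

lemma ideal_ext_ideal: "ideal (ext_ideal X) free_alg"
  unfolding ext_ideal_def
  by (rule ring.genideal_ideal[OF ring_free_alg]) (simp only: free_alg_simps subset_UNIV)

lemma ideal_free_algI:
  assumes "0 \<in> J" "\<And>x y. x \<in> J \<Longrightarrow> y \<in> J \<Longrightarrow> x + y \<in> J"
    "\<And>r x. x \<in> J \<Longrightarrow> r * x \<in> J" "\<And>r x. x \<in> J \<Longrightarrow> x * r \<in> J"
  shows "ideal J (free_alg :: ('v tword \<Rightarrow>\<^sub>0 'k::comm_ring_1) ring)"
proof (rule idealI[OF ring_free_alg])
  interpret ring "free_alg :: ('v tword \<Rightarrow>\<^sub>0 'k) ring" by (rule ring_free_alg)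
  have um: "\<ominus>\<^bsub>free_alg\<^esub> a = - a" for a :: "'v tword \<Rightarrow>\<^sub>0 'k"
    by (rule minus_equality) (simp_all add: free_alg_simps)
  show "subgroup J (add_monoid (free_alg :: ('v tword \<Rightarrow>\<^sub>0 'k) ring))"
  proof (rule add.subgroupI)
    show "J \<noteq> {}" using assms(1) by auto
    show "\<ominus>\<^bsub>free_alg\<^esub> a \<in> J" if "a \<in> J" for a
      using assms(3)[OF that, of "- 1"] by (simp add: um)
  qed (simp_all add: free_alg_simps assms)
qed (simp_all add: free_alg_simps assms)

lemma
  shows ext_ideal_0: "0 \<in> ext_ideal X"
    and ext_ideal_add: "x \<in> ext_ideal X \<Longrightarrow> y \<in> ext_ideal X \<Longrightarrow> x + y \<in> ext_ideal X"
    and ext_ideal_lmult: "x \<in> ext_ideal X \<Longrightarrow> r * x \<in> ext_ideal X"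
    and ext_ideal_rmult: "x \<in> ext_ideal X \<Longrightarrow> x * r \<in> ext_ideal X"
proof -
  interpret ideal "ext_ideal X" "free_alg" by (rule ideal_ext_ideal)
  show "0 \<in> ext_ideal X" using additive_subgroup.zero_closed[OF additive_subgroup_axioms] by (simp add: free_alg_simps)
  show "x + y \<in> ext_ideal X" if "x \<in> ext_ideal X" "y \<in> ext_ideal X"
    using additive_subgroup.a_closed[OF additive_subgroup_axioms that] by (simp add: free_alg_simps)
  show "r * x \<in> ext_ideal X" if "x \<in> ext_ideal X"
    using I_l_closed[OF that, of r] by (simp add: free_alg_simps)
  show "x * r \<in> ext_ideal X" if "x \<in> ext_ideal X"
    using I_r_closed[OF that, of r] by (simp add: free_alg_simps)
qed

lemma ext_ideal_uminus: "x \<in> ext_ideal X \<Longrightarrow> - x \<in> ext_ideal X"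
  using ext_ideal_lmult[of x X "- 1"] by simp

lemma ext_ideal_diff: "x \<in> ext_ideal X \<Longrightarrow> y \<in> ext_ideal X \<Longrightarrow> x - y \<in> ext_ideal X"
  using ext_ideal_add[of x X "- y"] ext_ideal_uminus[of y X] by simp

lemma ext_ideal_linear:
  "gen (scl X a v + scl X b w) - (const a * gen v + const b * gen w) \<in> ext_ideal X"
  and ext_ideal_square: "gen v * gen v \<in> ext_ideal X"
proof -
  note self = ring.genideal_self[OF ring_free_alg, unfolded free_alg_simps, OF subset_UNIV]
  show "gen (scl X a v + scl X b w) - (const a * gen v + const b * gen w) \<in> ext_ideal X"
    unfolding ext_ideal_def by (rule subsetD[OF self]) blast
  show "gen v * gen v \<in> ext_ideal X"
    unfolding ext_ideal_def by (rule subsetD[OF self]) blast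
qed

text \<open>
  This is how a linear map or a bilinear form on the free algebra is shown to descend to the
  exterior algebra: the elements that it kills contain an ideal \<open>J\<close> with the two kinds of relations.
\<close>

lemma ext_ideal_subset:
  assumes "ideal J free_alg"
    and "\<And>a b v w. gen (scl X a v + scl X b w) - (const a * gen v + const b * gen w) \<in> J"
    and "\<And>v. gen v * gen v \<in> J"
  shows "ext_ideal X \<subseteq> J"
  unfolding ext_ideal_def
  by (rule ring.genideal_minimal[OF ring_free_alg assms(1)]) (use assms(2,3) in blast)

lemma ext_class_eq: "ext_class X x = {h + x | h. h \<in> ext_ideal X}"
  by (auto simp: ext_class_def a_r_coset_def' free_alg_simps)

lemma ext_class_eq_iff: "ext_class X x = ext_class X y \<longleftrightarrow> x - y \<in> ext_ideal X"
proof
  assume "ext_class X x = ext_class X y"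
  moreover have "x \<in> ext_class X x"
    using ext_ideal_0 by (force simp: ext_class_eq)
  ultimately show "x - y \<in> ext_ideal X" by (auto simp: ext_class_eq)
next
  have sub: "ext_class X x \<subseteq> ext_class X y" if "x - y \<in> ext_ideal X" for x y
  proof
    fix z assume "z \<in> ext_class X x"
    then obtain h where h: "h \<in> ext_ideal X" "z = h + x" by (auto simp: ext_class_eq)
    then have "z = (h + (x - y)) + y" "h + (x - y) \<in> ext_ideal X"
      using that by (simp_all add: ext_ideal_add)
    then show "z \<in> ext_class X y" unfolding ext_class_eq by blast
  qed
  assume *: "x - y \<in> ext_ideal X"
  then have "y - x \<in> ext_ideal X" using ext_ideal_uminus[OF *] by simp
  with * show "ext_class X x = ext_class X y" by (intro equalityI sub)
qed

lemma carrier_exterior: "carrier (exterior X) = range (ext_class X)"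
  by (auto simp: exterior_def FactRing_def A_RCOSETS_def' ext_class_def free_alg_simps)

lemma ext_class_carrier [simp]: "ext_class X x \<in> carrier (exterior X)"
  by (simp add: carrier_exterior)

lemma wedge_class: "ext_class X x \<and>\<^bsub>X\<^esub> ext_class X y = ext_class X (x * y)"
  using ideal.rcoset_mult_add[OF ideal_ext_ideal, of x y X]
  by (simp add: exterior_def FactRing_def ext_class_def free_alg_simps)

lemma one_exterior: "\<one>\<^bsub>exterior X\<^esub> = ext_class X 1"
  by (simp add: exterior_def FactRing_def ext_class_def free_alg_simps)

lemma zero_exterior: "\<zero>\<^bsub>exterior X\<^esub> = ext_class X 0"
  by (auto simp add: exterior_def FactRing_def ext_class_eq free_alg_simps)

lemma add_exterior: "ext_class X x \<oplus>\<^bsub>exterior X\<^esub> ext_class X y = ext_class X (x + y)"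
  using ideal.a_rcos_sum[OF ideal_ext_ideal, of x y X]
  by (simp add: exterior_def FactRing_def ext_class_def free_alg_simps)

lemma ext_class_0_iff: "ext_class X x = ext_class X 0 \<longleftrightarrow> x \<in> ext_ideal X"
  by (simp add: ext_class_eq_iff)

lemma ext_scl_class: "ext_scl X c (ext_class X x) = ext_class X (const c * x)"
  by (simp add: ext_scl_def ext_scalar_def wedge_class)

lemma wedge_list_class: "wedge_list X vs = ext_class X (word vs)"
  by (induction vs) (simp_all add: wedge_list_def one_exterior word_Nil ext_vec_def wedge_class word_Cons)

section \<open>Gram determinants\<close>

lemma (in fin_inner_space) ip_add_left: "ip X (x + y) z = ip X x z + ip X y z"
  by (metis ip_conjugate ip_add_right conjugate_dist_add)

lemma (in fin_inner_space) ip_scl_left: "ip X (scl X c x) z = conjugate c * ip X x z"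
  by (metis ip_conjugate ip_scl_right conjugate_dist_mul)

lemma (in fin_inner_space) gram_conjugate: "gram X ws vs = conjugate (gram X vs ws)"
proof (cases "length vs = length ws")
  case True
  let ?n = "length ws"
  interpret comm_ring_hom "conjugate :: 'k \<Rightarrow> 'k" by (rule conjugate_comm_ring_hom)
  have "mat ?n ?n (\<lambda>(i, j). ip X (ws ! i) (vs ! j)) =
      transpose_mat (map_mat conjugate (mat ?n ?n (\<lambda>(i, j). ip X (vs ! i) (ws ! j))))"
    by (rule eq_matI) (auto intro: ip_conjugate)
  then have "det (mat ?n ?n (\<lambda>(i, j). ip X (ws ! i) (vs ! j))) =
      conjugate (det (mat ?n ?n (\<lambda>(i, j). ip X (vs ! i) (ws ! j))))"
    by (simp add: det_transpose[of _ ?n])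
  then show ?thesis using True by (simp add: gram_def)
qed (simp add: gram_def)

text \<open>
  Laplace expansion along the column of the varied vector: the cofactors do not see that column.
\<close>

lemma (in fin_inner_space) gram_linear:
  "gram X us (as @ (scl X c v + scl X d w) # bs) =
     c * gram X us (as @ v # bs) + d * gram X us (as @ w # bs)"
proof (cases "length us = Suc (length as + length bs)")
  case True
  let ?n = "length us" and ?j = "length as"
  define M where "M z = mat ?n ?n (\<lambda>(i, j). ip X (us ! i) ((as @ z # bs) ! j))" for z
  have M: "M z \<in> carrier_mat ?n ?n" for z by (simp add: M_def)
  have j: "?j < ?n" using True by simp
  have cof: "cofactor (M z) i ?j = cofactor (M v) i ?j" if "i < ?n" for z i
  proof -
    have nth: "(as @ z # bs) ! k = (as @ v # bs) ! k" if "k \<noteq> ?j" for k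
      using that by (cases "k < ?j") (simp_all add: nth_append nth_Cons')
    have "mat_delete (M z) i ?j = mat_delete (M v) i ?j"
    proof (rule eq_matI)
      fix r s assume "r < dim_row (mat_delete (M v) i ?j)" "s < dim_col (mat_delete (M v) i ?j)"
      then have rs: "r < ?n - 1" "s < ?n - 1" by (simp_all add: M_def)
      define r' where "r' = (if r < i then r else Suc r)"
      define s' where "s' = (if s < ?j then s else Suc s)"
      have s': "s' \<noteq> ?j" "s' < ?n" "r' < ?n" using rs by (auto simp: s'_def r'_def)
      have del: "mat_delete (M y) i ?j $$ (r, s) = M y $$ (r', s')" for y
        using rs by (simp add: mat_delete_def M_def s'_def r'_def)
      have "M z $$ (r', s') = M v $$ (r', s')"
        using s' by (simp add: M_def nth)
      then show "mat_delete (M z) i ?j $$ (r, s) = mat_delete (M v) i ?j $$ (r, s)"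
        by (simp only: del)
    qed (simp_all add: M_def)
    then show ?thesis by (simp add: cofactor_def)
  qed
  have ent: "M z $$ (i, ?j) = ip X (us ! i) z" if "i < ?n" for z i
    using that j by (simp add: M_def)
  have lap: "det (M z) = (\<Sum>i<?n. ip X (us ! i) z * cofactor (M v) i ?j)" for z
    by (subst laplace_expansion_column[OF M j], rule sum.cong[OF refl])
      (simp add: cof[of _ z] ent)
  have "gram X us (as @ z # bs) = det (M z)" for z
    using True by (simp add: gram_def M_def)
  then show ?thesis
    by (simp add: lap ip_add_right ip_scl_right sum.distrib sum_distrib_left algebra_simps)
qed (simp add: gram_def)

lemma gram_alternating: "gram X us (as @ v # v # bs) = 0"
proof (cases "length us = length as + (2 + length bs)")
  case True
  define n where "n = length us"
  define ws where "ws = as @ v # v # bs"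
  define M where "M = mat n n (\<lambda>(i, j). ip X (us ! i) (ws ! j))"
  have M: "M \<in> carrier_mat n n" by (simp add: M_def)
  have j: "length as < n" "Suc (length as) < n" using True by (simp_all add: n_def)
  have nth: "ws ! length as = v" "ws ! Suc (length as) = v"
    by (simp_all add: ws_def nth_append)
  have "col M (length as) = col M (Suc (length as))"
    by (rule eq_vecI) (use j in \<open>simp_all add: M_def nth\<close>)
  then have "det M = 0"
    by (intro det_identical_columns[OF M _ j]) simp_all
  then show ?thesis using True by (simp add: gram_def M_def n_def ws_def)
qed (simp add: gram_def)

section \<open>The inner product of the exterior algebra\<close>

text \<open>
  The sesquilinear extension of the Gram determinant to the free algebra.  It is proved to vanish
  on the ideal, so that it computes \<open>ext_ip\<close> on arbitrary representatives.
\<close>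

definition free_ip :: "('k::real_or_complex, 'v::ab_group_add) ips \<Rightarrow>
    ('v tword \<Rightarrow>\<^sub>0 'k) \<Rightarrow> ('v tword \<Rightarrow>\<^sub>0 'k) \<Rightarrow> 'k" where
  "free_ip X x y = (\<Sum>u\<in>Poly_Mapping.keys x. \<Sum>w\<in>Poly_Mapping.keys y.
     conjugate (Poly_Mapping.lookup x u) * Poly_Mapping.lookup y w * gram X (letters u) (letters w))"

text \<open>
  Two elements have different supports, so additivity is proved by summing over a common superset.
\<close>

lemma free_ip_superset:
  assumes "finite U" "Poly_Mapping.keys x \<subseteq> U" "finite W" "Poly_Mapping.keys y \<subseteq> W"
  shows "free_ip X x y = (\<Sum>u\<in>U. \<Sum>w\<in>W.
     conjugate (Poly_Mapping.lookup x u) * Poly_Mapping.lookup y w * gram X (letters u) (letters w))"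
proof -
  have "(\<Sum>u\<in>Poly_Mapping.keys x. \<Sum>w\<in>Poly_Mapping.keys y. conjugate (Poly_Mapping.lookup x u) * Poly_Mapping.lookup y w * gram X (letters u) (letters w))
     = (\<Sum>u\<in>Poly_Mapping.keys x. \<Sum>w\<in>W. conjugate (Poly_Mapping.lookup x u) * Poly_Mapping.lookup y w * gram X (letters u) (letters w))"
    using assms(3,4) by (intro sum.cong refl sum.mono_neutral_left) (auto simp: in_keys_iff)
  also have "\<dots> = (\<Sum>u\<in>U. \<Sum>w\<in>W. conjugate (Poly_Mapping.lookup x u) * Poly_Mapping.lookup y w * gram X (letters u) (letters w))"
    using assms(1,2) by (intro sum.mono_neutral_left) (auto simp: in_keys_iff)
  finally show ?thesis by (simp add: free_ip_def)
qed

lemma free_ip_add_right: "free_ip X x (y + z) = free_ip X x y + free_ip X x z"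
proof -
  let ?W = "Poly_Mapping.keys y \<union> Poly_Mapping.keys z"
  have "free_ip X x t = (\<Sum>u\<in>Poly_Mapping.keys x. \<Sum>w\<in>?W.
     conjugate (Poly_Mapping.lookup x u) * Poly_Mapping.lookup t w * gram X (letters u) (letters w))" if "Poly_Mapping.keys t \<subseteq> ?W" for t
    by (rule free_ip_superset) (use that in auto)
  then show ?thesis
    using keys_add[of y z] by (simp add: lookup_add sum.distrib algebra_simps)
qed

lemma free_ip_add_left: "free_ip X (x + y) z = free_ip X x z + free_ip X y z"
proof -
  let ?W = "Poly_Mapping.keys x \<union> Poly_Mapping.keys y"
  have "free_ip X t z = (\<Sum>u\<in>?W. \<Sum>w\<in>Poly_Mapping.keys z.
     conjugate (Poly_Mapping.lookup t u) * Poly_Mapping.lookup z w * gram X (letters u) (letters w))" if "Poly_Mapping.keys t \<subseteq> ?W" for t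
    by (rule free_ip_superset) (use that in auto)
  then show ?thesis
    using keys_add[of x y] by (simp add: lookup_add conjugate_dist_add sum.distrib algebra_simps)
qed

lemma free_ip_const_right: "free_ip X x (const c * y) = c * free_ip X x y"
proof -
  have "free_ip X x (const c * y) = (\<Sum>u\<in>Poly_Mapping.keys x. \<Sum>w\<in>Poly_Mapping.keys y.
     conjugate (Poly_Mapping.lookup x u) * Poly_Mapping.lookup (const c * y) w * gram X (letters u) (letters w))"
    by (rule free_ip_superset) (use keys_const_mult in auto)
  then show ?thesis
    by (simp add: lookup_const_mult free_ip_def sum_distrib_left algebra_simps)
qed

lemma free_ip_const_left: "free_ip X (const c * x) y = conjugate c * free_ip X x y"
proof -
  have "free_ip X (const c * x) y = (\<Sum>u\<in>Poly_Mapping.keys x. \<Sum>w\<in>Poly_Mapping.keys y.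
     conjugate (Poly_Mapping.lookup (const c * x) u) * Poly_Mapping.lookup y w * gram X (letters u) (letters w))"
    by (rule free_ip_superset) (use keys_const_mult in auto)
  then show ?thesis
    by (simp add: lookup_const_mult free_ip_def sum_distrib_left conjugate_dist_mul algebra_simps)
qed

lemma free_ip_0 [simp]: "free_ip X x 0 = 0" "free_ip X 0 y = 0"
  by (simp_all add: free_ip_def)

lemma free_ip_uminus_right: "free_ip X x (- y) = - free_ip X x y"
  using free_ip_add_right[of X x y "- y"] by (simp add: eq_neg_iff_add_eq_0 add.commute)

lemma free_ip_diff_right: "free_ip X x (y - z) = free_ip X x y - free_ip X x z"
  using free_ip_add_right[of X x y "- z"] by (simp add: free_ip_uminus_right)

lemma free_ip_sum_right: "free_ip X x (sum f S) = (\<Sum>i\<in>S. free_ip X x (f i))"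
  by (induction S rule: infinite_finite_induct) (simp_all add: free_ip_add_right)

lemma free_ip_sum_left: "free_ip X (sum f S) y = (\<Sum>i\<in>S. free_ip X (f i) y)"
  by (induction S rule: infinite_finite_induct) (simp_all add: free_ip_add_left)

lemma free_ip_word [simp]: "free_ip X (word us) (word vs) = gram X us vs"
  by (simp add: free_ip_def word_def)

context fin_inner_space
begin

lemma free_ip_conjugate: "free_ip X y x = conjugate (free_ip X x y)"
proof -
  have "conjugate (free_ip X x y) = (\<Sum>u\<in>Poly_Mapping.keys x. \<Sum>w\<in>Poly_Mapping.keys y.
      conjugate (Poly_Mapping.lookup y w) * Poly_Mapping.lookup x u * gram X (letters w) (letters u))"
    by (simp add: free_ip_def sum_conjugate conjugate_dist_mul gram_conjugate[symmetric] mult_ac)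
  also have "\<dots> = free_ip X y x"
    unfolding free_ip_def by (rule sum.swap)
  finally show ?thesis by simp
qed

text \<open>
  The radical of a form need not be an ideal.  The set \<open>J\<close> of the elements whose two-sided
  multiples all lie in the radical is one by construction, and for the relations membership in \<open>J\<close>
  is linearity and alternation of Gram determinants at an arbitrary position.
\<close>

lemma free_ip_ideal_right:
  assumes "y \<in> ext_ideal X"
  shows "free_ip X x y = 0"
proof -
  define J where "J = {y. \<forall>x a b. free_ip X x (a * y * b) = 0}"
  have zeroI: "y \<in> J" if "\<And>us as bs. free_ip X (word us) (word as * y * word bs) = 0" for y
  proof -
    have 1: "free_ip X x (word as * y * word bs) = 0" for x as bs
      by (induction x rule: free_alg_induct)
        (simp_all add: free_ip_add_left free_ip_const_left that)
    have 2: "free_ip X x (a * y * word bs) = 0" for x a bs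
      by (induction a rule: free_alg_induct)
        (simp_all add: distrib_right mult.assoc free_ip_add_right free_ip_const_right
          1[unfolded mult.assoc])
    have "free_ip X x (a * y * b) = 0" for x a b
      by (induction b rule: free_alg_induct)
        (simp_all add: distrib_left mult.assoc free_ip_add_right free_ip_const_right
          const_left_commute 2[unfolded mult.assoc])
    then show ?thesis by (simp add: J_def)
  qed
  have "ext_ideal X \<subseteq> J"
  proof (rule ext_ideal_subset)
    show "ideal J free_alg"
    proof (rule ideal_free_algI)
      show "r * x \<in> J" if "x \<in> J" for r x
        using that by (simp add: J_def mult.assoc[symmetric])
      show "x * r \<in> J" if "x \<in> J" for r x
        using that by (simp add: J_def mult.assoc)
    qed (simp_all add: J_def distrib_left distrib_right free_ip_add_right)
  next
    fix a b v w
    have "free_ip X (word us) (word as *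
        (gen (scl X a v + scl X b w) - (const a * gen v + const b * gen w)) * word bs) = 0"
      for us as bs
    proof -
      have "word as * (gen (scl X a v + scl X b w) - (const a * gen v + const b * gen w)) * word bs =
         word (as @ (scl X a v + scl X b w) # bs) -
         (const a * word (as @ v # bs) + const b * word (as @ w # bs))"
        by (simp add: word_append word_Cons algebra_simps const_left_commute)
      then show ?thesis
        by (simp add: free_ip_diff_right free_ip_add_right free_ip_const_right gram_linear)
    qed
    then show "gen (scl X a v + scl X b w) - (const a * gen v + const b * gen w) \<in> J"
      by (rule zeroI)
  next
    fix v
    have "free_ip X (word us) (word as * (gen v * gen v) * word bs) = 0" for us as bs
    proof -
      have "word as * (gen v * gen v) * word bs = (word (as @ v # v # bs) :: 'v tword \<Rightarrow>\<^sub>0 'k)"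
        by (simp add: word_append word_Cons mult.assoc)
      then show ?thesis by (simp only: free_ip_word gram_alternating)
    qed
    then show "gen v * gen v \<in> J" by (rule zeroI)
  qed
  then have "free_ip X x (1 * y * 1) = 0" using assms unfolding J_def by blast
  then show ?thesis by simp
qed

lemma ext_ip_class: "ext_ip X (ext_class X x) (ext_class X y) = free_ip X x y"
proof -
  have rep: "(SOME z. z \<in> ext_class X x) - x \<in> ext_ideal X" for x
  proof -
    have "x \<in> ext_class X x" using ext_ideal_0 by (force simp: ext_class_eq)
    then have "(SOME z. z \<in> ext_class X x) \<in> ext_class X x" by (rule someI)
    then show ?thesis by (auto simp: ext_class_eq)
  qed
  define x' y' where "x' = (SOME z. z \<in> ext_class X x)" "y' = (SOME z. z \<in> ext_class X y)"
  have "free_ip X x' (y' - y) = 0" "free_ip X y (x' - x) = 0"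
    unfolding x'_y'_def by (rule free_ip_ideal_right[OF rep])+
  then have "free_ip X x' y' = free_ip X x' y" "free_ip X y x' = free_ip X y x"
    by (simp_all add: free_ip_diff_right)
  then have "free_ip X x' y' = free_ip X x y"
    by (metis free_ip_conjugate)
  then show ?thesis
    by (simp add: ext_ip_def Let_def free_ip_def x'_y'_def[symmetric])
qed

end


sublocale fin_inner_space \<subseteq> vs: vector_space "scl X"
  using fin_dim by (auto simp: finite_dimensional_vector_space_def)

section \<open>Spanning the exterior algebra by increasing words\<close>

text \<open>
  These lists index the standard spanning set of
  the \<open>k\<close>-th exterior power of a space spanned by \<open>m\<close> vectors.
\<close>

definition increasing :: "nat \<Rightarrow> nat \<Rightarrow> nat list set" where
  "increasing m k = {js. sorted_wrt (<) js \<and> set js \<subseteq> {..<m} \<and> length js = k}"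

lemma finite_increasing: "finite (increasing m k)"
  by (rule finite_subset[OF _ finite_lists_length_eq[of "{..<m}" k]])
    (auto simp: increasing_def)

lemma increasing_empty:
  assumes "m < k" shows "increasing m k = {}"
proof -
  have "length js \<le> m" if "sorted_wrt (<) js" "set js \<subseteq> {..<m}" for js
    using that card_mono[of "{..<m}" "set js"] by (simp add: strict_sorted_iff distinct_card)
  with assms show ?thesis by (fastforce simp: increasing_def)
qed

lemma increasing_full: "increasing m m = {[0..<m]}"
proof -
  have "js = [0..<m]" if js: "sorted_wrt (<) js" "set js \<subseteq> {..<m}" "length js = m" for js
  proof -
    have "card (set js) = card {..<m}"
      using js by (simp add: strict_sorted_iff distinct_card)
    then have "set js = {..<m}" using js(2) by (intro card_subset_eq) auto
    then have "set js = set [0..<m]" by (simp add: lessThan_atLeast0)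
    with js(1) show ?thesis
      by (intro sorted_distinct_set_unique) (simp_all add: strict_sorted_iff)
  qed
  then show ?thesis by (auto simp: increasing_def)
qed

definition subword :: "'v list \<Rightarrow> nat list \<Rightarrow> ('v tword \<Rightarrow>\<^sub>0 'k::comm_ring_1)" where
  "subword es js = word (map ((!) es) js)"

lemma subword_full: "subword es [0..<length es] = word es"
  by (simp add: subword_def map_nth)

definition spanned :: "('k::real_or_complex, 'v::ab_group_add) ips \<Rightarrow> 'v list \<Rightarrow> nat list set \<Rightarrow>
    ('v tword \<Rightarrow>\<^sub>0 'k) \<Rightarrow> bool" where
  "spanned X es S x \<longleftrightarrow>
     (\<exists>c. ext_class X x = ext_class X (\<Sum>js\<in>S. const (c js) * subword es js))"

context fin_inner_space
begin

abbreviation cls :: "('v tword \<Rightarrow>\<^sub>0 'k) \<Rightarrow> ('v tword \<Rightarrow>\<^sub>0 'k) set" where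
  "cls \<equiv> ext_class X"

lemma cls_mult: "cls x = cls x' \<Longrightarrow> cls y = cls y' \<Longrightarrow> cls (x * y) = cls (x' * y')"
  by (metis wedge_class)

lemma cls_add: "cls x = cls x' \<Longrightarrow> cls y = cls y' \<Longrightarrow> cls (x + y) = cls (x' + y')"
  by (metis add_exterior)

lemma cls_gen_linear:
  "cls (gen (scl X a v + scl X b w)) = cls (const a * gen v + const b * gen w)"
  by (simp add: ext_class_eq_iff ext_ideal_linear)

lemma cls_gen_add: "cls (gen (v + w)) = cls (gen v + gen w)"
  using cls_gen_linear[of 1 v 1 w] by simp

lemma cls_gen_scl: "cls (gen (scl X a v)) = cls (const a * gen v)"
  using cls_gen_linear[of a v 0 0] by simp

lemma cls_gen_0: "cls (gen 0) = cls 0"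
  using cls_gen_scl[of 0 0] by simp

lemma cls_gen_anticommute: "cls (gen v * gen w) = cls (- (gen w * gen v))"
proof -
  have "cls (gen (v + w) * gen (v + w)) = cls ((gen v + gen w) * (gen v + gen w))"
    by (intro cls_mult cls_gen_add)
  then have "(gen v + gen w) * (gen v + gen w) \<in> ext_ideal X"
    using ext_ideal_square[of "v + w" X] by (metis ext_class_0_iff)
  then have "((gen v + gen w) * (gen v + gen w) - gen v * gen v) - gen w * gen w \<in> ext_ideal X"
    using ext_ideal_square[of v X] ext_ideal_square[of w X] by (intro ext_ideal_diff)
  then show ?thesis by (simp add: ext_class_eq_iff algebra_simps)
qed

lemma spanned_cong: "cls x = cls y \<Longrightarrow> spanned X es S x = spanned X es S y"
  by (simp add: spanned_def)

lemma spanned_0: "spanned X es S 0"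
  unfolding spanned_def by (rule exI[of _ "\<lambda>_. 0"]) simp

lemma spanned_add:
  assumes "spanned X es S x" "spanned X es S y" shows "spanned X es S (x + y)"
proof -
  from assms obtain c d
    where "cls x = cls (\<Sum>js\<in>S. const (c js) * subword es js)"
      and "cls y = cls (\<Sum>js\<in>S. const (d js) * subword es js)"
    by (auto simp: spanned_def)
  then have "cls (x + y) =
      cls ((\<Sum>js\<in>S. const (c js) * subword es js) + (\<Sum>js\<in>S. const (d js) * subword es js))"
    by (rule cls_add)
  then show ?thesis unfolding spanned_def
    by (intro exI[of _ "\<lambda>js. c js + d js"]) (simp add: const_add distrib_right sum.distrib)
qed

lemma spanned_const:
  assumes "spanned X es S x" shows "spanned X es S (const a * x)"
proof -
  from assms obtain c where "cls x = cls (\<Sum>js\<in>S. const (c js) * subword es js)"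
    by (auto simp: spanned_def)
  then have "cls (const a * x) = cls (const a * (\<Sum>js\<in>S. const (c js) * subword es js))"
    by (intro cls_mult refl)
  then show ?thesis unfolding spanned_def
    by (intro exI[of _ "\<lambda>js. a * c js"])
      (simp add: sum_distrib_left const_mult_const[symmetric] mult.assoc)
qed

lemma spanned_sum: "(\<And>i. i \<in> T \<Longrightarrow> spanned X es S (f i)) \<Longrightarrow> spanned X es S (sum f T)"
  by (induction T rule: infinite_finite_induct) (simp_all add: spanned_0 spanned_add)

lemma spanned_mono:
  assumes "spanned X es S x" "S \<subseteq> T" "finite T" shows "spanned X es T x"
proof -
  from assms obtain c where c: "cls x = cls (\<Sum>js\<in>S. const (c js) * subword es js)"
    by (auto simp: spanned_def)
  have "(\<Sum>js\<in>S. const (c js) * subword es js) =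
      (\<Sum>js\<in>T. const (if js \<in> S then c js else 0) * subword es js)"
    using assms(2,3) by (intro sum.mono_neutral_cong_left) auto
  with c show ?thesis unfolding spanned_def
    by (intro exI[of _ "\<lambda>js. if js \<in> S then c js else 0"]) simp
qed

lemma spanned_subword: "js \<in> S \<Longrightarrow> finite S \<Longrightarrow> spanned X es S (subword es js)"
  by (rule spanned_mono[of es "{js}"]) (auto simp: spanned_def intro: exI[of _ "\<lambda>_. 1"])

text \<open>
  A new factor is moved to its sorted place by anticommutation, and the product vanishes if it meets
  itself on the way.  The coefficient \<open>d\<close> is \<open>0\<close> or a sign.
\<close>

lemma gen_mult_subword:
  "sorted_wrt (<) js \<Longrightarrow>
    \<exists>d. (i \<in> set js \<longrightarrow> d = 0) \<and>
      cls (gen (es ! i) * subword es js) = cls (const d * subword es (insort i js))"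
proof (induction js)
  case Nil
  show ?case by (intro exI[of _ 1]) (simp add: subword_def word_Cons)
next
  case (Cons j js)
  then have j: "\<forall>k\<in>set js. j < k" and js: "sorted_wrt (<) js" by auto
  consider "i < j" | "i = j" | "j < i" by linarith
  then show ?case
  proof cases
    case 1
    then show ?thesis using j
      by (intro exI[of _ 1]) (auto simp: subword_def word_Cons)
  next
    case 2
    have "cls ((gen (es ! j) * gen (es ! j)) * subword es js) = cls 0"
      by (subst ext_class_0_iff) (intro ext_ideal_rmult ext_ideal_square)
    then show ?thesis using 2
      by (intro exI[of _ 0]) (simp add: subword_def word_Cons mult.assoc)
  next
    case 3
    from Cons.IH[OF js] obtain d where d: "i \<in> set js \<longrightarrow> d = 0"
      "cls (gen (es ! i) * subword es js) = cls (const d * subword es (insort i js))" by blast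
    have "cls (gen (es ! i) * subword es (j # js)) =
        cls ((gen (es ! i) * gen (es ! j)) * subword es js)"
      by (simp add: subword_def word_Cons mult.assoc)
    also have "\<dots> = cls ((- (gen (es ! j) * gen (es ! i))) * subword es js)"
      by (intro cls_mult cls_gen_anticommute refl)
    also have "\<dots> = cls ((- gen (es ! j)) * (gen (es ! i) * subword es js))"
      by (simp add: mult.assoc)
    also have "\<dots> = cls ((- gen (es ! j)) * (const d * subword es (insort i js)))"
      by (intro cls_mult d refl)
    also have "(- gen (es ! j)) * (const d * subword es (insort i js)) =
        const (- d) * subword es (insort i (j # js))"
      using 3 by (simp add: subword_def word_Cons const_left_commute const_uminus)
    finally show ?thesis using d 3 by (intro exI[of _ "- d"]) auto
  qed
qed

lemma spanned_gen_mult: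
  assumes v: "v \<in> vs.span (set es)" and x: "spanned X es (increasing (length es) k) x"
  shows "spanned X es (increasing (length es) (Suc k)) (gen v * x)"
proof -
  let ?I = "increasing (length es)"
  have base: "spanned X es (?I (Suc k)) (gen e * x)" if "e \<in> set es" for e
  proof -
    from that obtain i where i: "i < length es" "e = es ! i" by (auto simp: in_set_conv_nth)
    from x obtain c where "cls x = cls (\<Sum>js\<in>?I k. const (c js) * subword es js)"
      by (auto simp: spanned_def)
    then have "cls (gen e * x) = cls (gen e * (\<Sum>js\<in>?I k. const (c js) * subword es js))"
      by (intro cls_mult refl)
    also have "gen e * (\<Sum>js\<in>?I k. const (c js) * subword es js) =
        (\<Sum>js\<in>?I k. const (c js) * (gen e * subword es js))"
      by (simp add: sum_distrib_left const_left_commute)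
    finally have *: "cls (gen e * x) = cls \<dots>" .
    have "spanned X es (?I (Suc k)) (gen e * subword es js)" if js: "js \<in> ?I k" for js
    proof -
      from js gen_mult_subword[of js i es] obtain d where d: "i \<in> set js \<longrightarrow> d = 0"
        "cls (gen e * subword es js) = cls (const d * subword es (insort i js))"
        by (auto simp: increasing_def i)
      show ?thesis
      proof (cases "i \<in> set js")
        case True
        with d show ?thesis by (simp add: spanned_cong[OF d(2)] spanned_0)
      next
        case False
        with js i have "insort i js \<in> ?I (Suc k)"
          by (auto simp: increasing_def strict_sorted_iff sorted_insort distinct_insort set_insort_key)
        then show ?thesis
          by (simp add: spanned_cong[OF d(2)] spanned_const spanned_subword finite_increasing)
      qed
    qed
    then show ?thesis
      by (subst spanned_cong[OF *]) (intro spanned_sum spanned_const)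
  qed
  from v show ?thesis
  proof (induction v rule: vs.span_induct_alt)
    case base
    have "cls (gen 0 * x) = cls (0 * x)" by (intro cls_mult cls_gen_0 refl)
    then show ?case by (simp add: spanned_cong[of "gen 0 * x" 0] spanned_0)
  next
    case (step c v w)
    have "cls (gen (scl X c v + w) * x) = cls ((const c * gen v + gen w) * x)"
      by (intro cls_mult refl) (metis cls_gen_add cls_gen_scl cls_add)
    also have "(const c * gen v + gen w) * x = const c * (gen v * x) + gen w * x"
      by (simp add: distrib_right mult.assoc)
    finally have "cls (gen (scl X c v + w) * x) = cls (const c * (gen v * x) + gen w * x)" .
    from spanned_cong[OF this] show ?case
      by simp (use step assms(1) in \<open>auto intro!: spanned_add spanned_const base\<close>)
  qed
qed

lemma spanned_word:
  "set ws \<subseteq> vs.span (set es) \<Longrightarrow> spanned X es (increasing (length es) (length ws)) (word ws)"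
proof (induction ws)
  case Nil
  have "[] \<in> increasing (length es) 0" by (simp add: increasing_def)
  from spanned_subword[OF this finite_increasing] show ?case
    by (simp add: subword_def)
next
  case (Cons w ws)
  then show ?case by (simp add: word_Cons spanned_gen_mult)
qed

text \<open>
  More factors than spanning vectors: there is no increasing index list of that length.
\<close>

lemma word_eq_0:
  assumes "set ws \<subseteq> vs.span (set es)" "length es < length ws"
  shows "cls (word ws) = cls 0"
  using spanned_word[OF assms(1)] increasing_empty[OF assms(2)] by (simp add: spanned_def)

text \<open>
  As many factors as spanning vectors: there is a single increasing index list.  The constant is
  the determinant of the coordinates of \<open>ws\<close> if \<open>es\<close> is independent.
\<close>

lemma word_proportional:
  assumes "set ws \<subseteq> vs.span (set es)" "length ws = length es"
  obtains c where "cls (word ws) = cls (const c * word es)"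
  using spanned_word[OF assms(1)]
  by (auto simp: assms(2) increasing_full spanned_def subword_full)

section \<open>Orthonormal lists\<close>

lemma ip_0_right [simp]: "ip X x 0 = 0"
  using ip_scl_right[of x 0 0] by simp

lemma ip_0_left [simp]: "ip X 0 x = 0"
  using ip_scl_left[of 0 0 x] by simp

lemma ip_diff_right: "ip X x (y - z) = ip X x y - ip X x z"
  using ip_add_right[of x "y - z" z] by simp

lemma ip_sum_right: "ip X x (sum f S) = (\<Sum>i\<in>S. ip X x (f i))"
  by (induction S rule: infinite_finite_induct) (simp_all add: ip_add_right)

lemma ip_eq_0_commute: "ip X x y = 0 \<Longrightarrow> ip X y x = 0"
  by (subst ip_conjugate) simp

lemma ip_self_eq_0: "ip X x x = 0 \<Longrightarrow> x = 0"
  using ip_pos[of x] by fastforce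

lemma perp_iff: "x \<in> perp X (vs.span S) \<longleftrightarrow> (\<forall>s\<in>S. ip X s x = 0)"
proof
  assume *: "\<forall>s\<in>S. ip X s x = 0"
  have "ip X v x = 0" if "v \<in> vs.span S" for v
    using that by (induction v rule: vs.span_induct_alt) (simp_all add: * ip_add_left ip_scl_left)
  then show "x \<in> perp X (vs.span S)" by (simp add: perp_def)
qed (simp add: perp_def vs.span_base)

definition orthonormal :: "'v list \<Rightarrow> bool" where
  "orthonormal es \<longleftrightarrow> distinct es \<and>
     (\<forall>a\<in>set es. \<forall>b\<in>set es. ip X a b = (if a = b then 1 else 0))"

lemma orthonormal_append:
  "orthonormal (as @ bs) \<longleftrightarrow>
     orthonormal as \<and> orthonormal bs \<and> (\<forall>a\<in>set as. \<forall>b\<in>set bs. ip X a b = 0)"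
proof (intro iffI conjI)
  assume R: "orthonormal as \<and> orthonormal bs \<and> (\<forall>a\<in>set as. \<forall>b\<in>set bs. ip X a b = 0)"
  have "ip X x x = 1" if "x \<in> set as" for x using that R by (auto simp: orthonormal_def)
  with R have "set as \<inter> set bs = {}" by fastforce
  moreover have "ip X b a = 0" if "a \<in> set as" "b \<in> set bs" for a b
    using that R ip_eq_0_commute by blast
  ultimately show "orthonormal (as @ bs)"
    using R by (auto simp: orthonormal_def)
qed (auto simp: orthonormal_def)

lemma orthonormal_nth:
  assumes "orthonormal es" "i < length es" "j < length es"
  shows "ip X (es ! i) (es ! j) = (if i = j then 1 else 0)"
  using assms nth_eq_iff_index_eq[of es i j] by (auto simp: orthonormal_def)

text \<open>
  The orthogonal projection onto the span of \<open>es\<close> when \<open>es\<close> is orthonormal.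
\<close>

definition orth_proj :: "'v list \<Rightarrow> 'v \<Rightarrow> 'v" where
  "orth_proj es v = (\<Sum>e\<in>set es. scl X (ip X e v) e)"

lemma orth_proj_in_span: "orth_proj es v \<in> vs.span (set es)"
  unfolding orth_proj_def by (intro vs.span_sum vs.span_scale vs.span_base)

lemma ip_orth_proj:
  assumes "orthonormal es" "e \<in> set es"
  shows "ip X e (orth_proj es v) = ip X e v"
proof -
  have "ip X e (orth_proj es v) = (\<Sum>f\<in>set es. if f = e then ip X f v else 0)"
    unfolding orth_proj_def ip_sum_right
    using assms by (intro sum.cong) (auto simp: ip_scl_right orthonormal_def)
  then show ?thesis using assms(2) by simp
qed

lemma orth_proj_residual:
  assumes "orthonormal es" shows "v - orth_proj es v \<in> perp X (vs.span (set es))"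
  by (simp add: perp_iff ip_diff_right ip_orth_proj[OF assms])

lemma span_inter_perp:
  assumes "v \<in> V" "v \<in> perp X V" shows "v = 0"
  using assms by (intro ip_self_eq_0) (simp add: perp_def)

lemma orth_proj_id:
  assumes "orthonormal es" "v \<in> vs.span (set es)" shows "orth_proj es v = v"
proof -
  have "v - orth_proj es v \<in> vs.span (set es)"
    using assms(2) orth_proj_in_span by (rule vs.span_diff)
  from span_inter_perp[OF this orth_proj_residual[OF assms(1)]] show ?thesis by simp
qed

lemma orthonormal_independent:
  assumes "orthonormal es" shows "vs.independent (set es)"
proof
  assume "vs.dependent (set es)"
  then obtain e where e: "e \<in> set es" "e \<in> vs.span (set es - {e})"
    by (auto simp: vs.dependent_def)
  have "e \<in> perp X (vs.span (set es - {e}))"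
    using assms e(1) by (auto simp: perp_iff orthonormal_def)
  with e(2) have "e = 0" by (rule span_inter_perp)
  with assms e(1) have "ip X 0 0 = 1" unfolding orthonormal_def by metis
  then show False by simp
qed

lemma orthonormal_length_le:
  assumes "orthonormal es" "set es \<subseteq> vs.span (set vs)"
  shows "length es \<le> length vs"
proof -
  have "card (set es) \<le> card (set vs)"
    using vs.independent_span_bound[OF _ orthonormal_independent[OF assms(1)] assms(2)] by simp
  also have "\<dots> \<le> length vs" by (rule card_length)
  finally show ?thesis using assms(1) by (simp add: orthonormal_def distinct_card)
qed

lemma orthonormal_length_eq:
  assumes "orthonormal es" "orthonormal fs" "vs.span (set es) = vs.span (set fs)"
  shows "length es = length fs"
proof (rule antisym)
  show "length es \<le> length fs"
    by (rule orthonormal_length_le[OF assms(1)]) (simp add: vs.span_superset flip: assms(3))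
  show "length fs \<le> length es"
    by (rule orthonormal_length_le[OF assms(2)]) (simp add: vs.span_superset assms(3))
qed

lemma orthonormal_basis_length:
  assumes "orthonormal es" "vs.span (set es) = UNIV"
  shows "length es = ips_dim X"
proof -
  have "ips_dim X = card (set es)"
    by (rule vs.dim_unique[OF _ _ orthonormal_independent[OF assms(1)] refl])
      (simp_all add: assms(2))
  then show ?thesis using assms(1) by (simp add: orthonormal_def distinct_card)
qed

text \<open>
  The Gram-Schmidt process, one vector of \<open>us\<close> at a time; a vector with zero residual is dropped.
\<close>

lemma orthonormal_extend:
  assumes "orthonormal es"
  obtains fs where "orthonormal (es @ fs)"
    "vs.span (set (es @ fs)) = vs.span (set es \<union> set us)"
  using assms
proof (induction us arbitrary: es thesis)
  case Nil
  show ?case by (rule Nil.prems(1)[of "[]"]) (simp_all add: Nil.prems)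
next
  case (Cons u us)
  define w where "w = u - orth_proj es u"
  have u: "u = orth_proj es u + w" by (simp add: w_def)
  show ?case
  proof (cases "w = 0")
    case True
    then have "u \<in> vs.span (set es)" using u orth_proj_in_span[of es u] by simp
    then have "u \<in> vs.span (set es \<union> set us)" using vs.span_mono[of "set es" "set es \<union> set us"] by auto
    then have "vs.span (set es \<union> set (u # us)) = vs.span (set es \<union> set us)"
      by (simp add: vs.span_redundant)
    with Cons.IH[OF _ Cons.prems(2)] Cons.prems(1) show ?thesis by metis
  next
    case False
    then obtain r where r: "0 < r" "ip X w w = of_real r" using ip_pos by blast
    define c :: 'k where "c = of_real (1 / sqrt r)"
    have c0: "c \<noteq> 0" using r by (simp add: c_def)
    define f where "f = scl X c w"
    have "ip X f f = conjugate c * (c * of_real r)"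
      by (simp add: f_def ip_scl_left ip_scl_right r)
    also have "\<dots> = of_real ((1 / sqrt r) * (1 / sqrt r) * r)"
      by (simp only: c_def conjugate_of_real of_real_mult mult.assoc)
    also have "(1 / sqrt r) * (1 / sqrt r) * r = 1" using r by simp
    finally have ff: "ip X f f = 1" by simp
    have "ip X e f = 0" if "e \<in> set es" for e
      using orth_proj_residual[OF Cons.prems(2), of u] that
      by (simp add: f_def ip_scl_right perp_iff w_def)
    then have on: "orthonormal (es @ [f])"
      using Cons.prems(2) ff by (simp add: orthonormal_append) (simp add: orthonormal_def)
    have fin: "f \<in> vs.span (set es \<union> set (u # us))"
    proof -
      have "orth_proj es u \<in> vs.span (set es \<union> set (u # us))"
        using orth_proj_in_span[of es u] vs.span_mono[of "set es" "set es \<union> set (u # us)"] by auto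
      then show ?thesis unfolding f_def w_def
        by (intro vs.span_scale vs.span_diff) (simp_all add: vs.span_base)
    qed
    have uin: "u \<in> vs.span (set (es @ [f]) \<union> set us)"
    proof -
      have "w = scl X (inverse c) f" using c0 by (simp add: f_def)
      then have "w \<in> vs.span (set (es @ [f]) \<union> set us)"
        by (simp add: vs.span_scale vs.span_base)
      moreover have "orth_proj es u \<in> vs.span (set (es @ [f]) \<union> set us)"
        using orth_proj_in_span[of es u] vs.span_mono[of "set es" "set (es @ [f]) \<union> set us"] by auto
      ultimately show ?thesis by (subst u) (rule vs.span_add)
    qed
    have "vs.span (set (es @ [f]) \<union> set us) = vs.span (set es \<union> set (u # us))"
    proof (rule vs.span_eq[THEN iffD2], rule conjI)
      show "set (es @ [f]) \<union> set us \<subseteq> vs.span (set es \<union> set (u # us))"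
        using fin by (auto simp: vs.span_base)
      show "set es \<union> set (u # us) \<subseteq> vs.span (set (es @ [f]) \<union> set us)"
        using uin by (auto simp: vs.span_base)
    qed
    with Cons.IH[OF _ on] Cons.prems(1) show ?thesis
      by (metis append.assoc append_Cons append_Nil)
  qed
qed

lemma orthonormal_span_basis:
  obtains es where "orthonormal es" "vs.span (set es) = vs.span (set us)"
  using orthonormal_extend[of "[]" us] by (auto simp: orthonormal_def)

text \<open>
  With \<open>es\<close> a basis of a subspace this gives a basis of the whole space adapted to it, in which stars
  and orthogonal complements can be read off.
\<close>

lemma orthonormal_extend_basis:
  assumes "orthonormal es"
  obtains fs where "orthonormal (es @ fs)" "vs.span (set (es @ fs)) = UNIV"
proof -
  from fin_dim obtain E where "finite_dimensional_vector_space (scl X) E" by blast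
  then have E: "finite E" "vs.span E = UNIV"
    by (auto simp: finite_dimensional_vector_space_def finite_dimensional_vector_space_axioms_def)
  from E(1) obtain us where us: "set us = E" by (meson finite_list)
  from orthonormal_extend[OF assms, of us] obtain fs where fs: "orthonormal (es @ fs)"
    "vs.span (set (es @ fs)) = vs.span (set es \<union> set us)" by blast
  moreover have "vs.span (set es \<union> set us) = UNIV"
    using E(2) us vs.span_mono[of "set us" "set es \<union> set us"] by auto
  ultimately show ?thesis using that by simp
qed

lemma perp_span_orthonormal:
  assumes "orthonormal (as @ bs)" "vs.span (set (as @ bs)) = UNIV"
  shows "perp X (vs.span (set as)) = vs.span (set bs)"
proof
  have b: "b \<in> perp X (vs.span (set as))" if "b \<in> set bs" for b
    using assms(1) that by (simp add: perp_iff orthonormal_append)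
  show "vs.span (set bs) \<subseteq> perp X (vs.span (set as))"
  proof
    fix x assume "x \<in> vs.span (set bs)"
    then show "x \<in> perp X (vs.span (set as))"
      by (induction x rule: vs.span_induct_alt)
        (use b in \<open>simp_all add: perp_iff ip_add_right ip_scl_right\<close>)
  qed
  show "perp X (vs.span (set as)) \<subseteq> vs.span (set bs)"
  proof
    fix x assume x: "x \<in> perp X (vs.span (set as))"
    have "x = orth_proj (as @ bs) x"
      using orth_proj_id[OF assms(1)] assms(2) by simp
    also have "\<dots> = (\<Sum>e\<in>set bs. scl X (ip X e x) e)"
      unfolding orth_proj_def
      by (rule sum.mono_neutral_right) (use x in \<open>auto simp: perp_iff\<close>)
    also have "\<dots> \<in> vs.span (set bs)" by (intro vs.span_sum vs.span_scale vs.span_base)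
    finally show "x \<in> vs.span (set bs)" .
  qed
qed

end


section \<open>Gram determinants of concatenated and orthonormal lists\<close>

context fin_inner_space
begin

text \<open>
  The Gram matrix is block triangular.  This rule and the next evaluate the determinants behind contractions,
  stars and norms; the blocks stay in their places, so no signs appear.
\<close>

lemma gram_block_upper:
  assumes "length as = length cs" "\<And>a d. a \<in> set as \<Longrightarrow> d \<in> set ds \<Longrightarrow> ip X a d = 0"
  shows "gram X (as @ bs) (cs @ ds) = gram X as cs * gram X bs ds"
proof (cases "length bs = length ds")
  case True
  define p q where "p = length cs" and "q = length ds"
  have len: "length as = p" "length cs = p" "length bs = q" "length ds = q"
    using True assms(1) by (simp_all add: p_def q_def)
  define A1 where "A1 = mat p p (\<lambda>(i, j). ip X (as ! i) (cs ! j))"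
  define A3 where "A3 = mat q p (\<lambda>(i, j). ip X (bs ! i) (cs ! j))"
  define A4 where "A4 = mat q q (\<lambda>(i, j). ip X (bs ! i) (ds ! j))"
  have car: "A1 \<in> carrier_mat p p" "A3 \<in> carrier_mat q p" "A4 \<in> carrier_mat q q"
    by (simp_all add: A1_def A3_def A4_def)
  have z: "ip X (as ! i) (ds ! j) = 0" if "i < p" "j < q" for i j
    using that by (intro assms(2)) (simp_all add: len)
  have "mat (p + q) (p + q) (\<lambda>(i, j). ip X ((as @ bs) ! i) ((cs @ ds) ! j)) =
      four_block_mat A1 (0\<^sub>m p q) A3 A4"
    by (rule eq_matI)
      (auto simp: A1_def A3_def A4_def nth_append len z)
  then show ?thesis
    using det_four_block_mat_upper_right_zero[OF car(1) refl car(2,3)]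
    by (simp add: gram_def len A1_def A4_def)
qed (simp add: gram_def assms(1))

lemma gram_block_lower:
  assumes "length bs = length ds" "\<And>b c. b \<in> set bs \<Longrightarrow> c \<in> set cs \<Longrightarrow> ip X b c = 0"
  shows "gram X (as @ bs) (cs @ ds) = gram X as cs * gram X bs ds"
proof (cases "length as = length cs")
  case True
  have "gram X (cs @ ds) (as @ bs) = gram X cs as * gram X ds bs"
    by (rule gram_block_upper) (use True assms ip_eq_0_commute in auto)
  then show ?thesis
    by (metis gram_conjugate conjugate_dist_mul)
qed (simp add: gram_def assms(1))

lemma gram_orthonormal: "orthonormal es \<Longrightarrow> gram X es es = 1"
proof -
  assume on: "orthonormal es"
  let ?n = "length es"
  have "mat ?n ?n (\<lambda>(i, j). ip X (es ! i) (es ! j)) = 1\<^sub>m ?n"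
    by (rule eq_matI) (auto simp: orthonormal_nth[OF on])
  then show ?thesis by (simp add: gram_def)
qed

definition all_increasing :: "nat \<Rightarrow> nat list set" where
  "all_increasing m = {js. sorted_wrt (<) js \<and> set js \<subseteq> {..<m}}"

lemma all_increasing_eq: "all_increasing m = (\<Union>k\<le>m. increasing m k)"
proof -
  have "length js \<le> m" if "sorted_wrt (<) js" "set js \<subseteq> {..<m}" for js
    using that card_mono[of "{..<m}" "set js"] by (simp add: strict_sorted_iff distinct_card)
  then show ?thesis by (auto simp: all_increasing_def increasing_def)
qed

lemma finite_all_increasing: "finite (all_increasing m)"
  by (simp add: all_increasing_eq finite_increasing)

lemma increasing_subset: "increasing m k \<subseteq> all_increasing m"
  by (auto simp: all_increasing_def increasing_def)

lemma orthonormal_map_nth: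
  assumes "orthonormal es" "distinct js" "set js \<subseteq> {..<length es}"
  shows "orthonormal (map ((!) es) js)"
proof -
  have inj: "inj_on ((!) es) (set js)"
    using assms by (intro inj_on_nth) (auto simp: orthonormal_def)
  have mem: "es ! j \<in> set es" if "j \<in> set js" for j
    using that assms(3) by (intro nth_mem) auto
  show ?thesis
    unfolding orthonormal_def
  proof (intro conjI ballI)
    show "distinct (map ((!) es) js)" using assms(2) inj by (simp add: distinct_map)
    fix a b assume "a \<in> set (map ((!) es) js)" "b \<in> set (map ((!) es) js)"
    then have "a \<in> set es" "b \<in> set es" using mem by auto
    then show "ip X a b = (if a = b then 1 else 0)"
      using assms(1) by (simp add: orthonormal_def)
  qed
qed

text \<open>
  Two different increasing lists of equal length: some index of the first is missing in the second, so
  its row of the Gram matrix is zero.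
\<close>

lemma gram_map_nth:
  assumes on: "orthonormal es"
    and js: "js \<in> all_increasing (length es)" and ks: "ks \<in> all_increasing (length es)"
  shows "gram X (map ((!) es) js) (map ((!) es) ks) = (if js = ks then 1 else 0)"
proof (cases "js = ks")
  case True
  then show ?thesis using js
    by (simp add: gram_orthonormal orthonormal_map_nth[OF on] all_increasing_def strict_sorted_iff)
next
  case False
  have "gram X (map ((!) es) js) (map ((!) es) ks) = 0"
  proof (cases "length js = length ks")
    case len: True
    have "\<not> set js \<subseteq> set ks"
    proof
      assume "set js \<subseteq> set ks"
      moreover have "card (set js) = card (set ks)"
        using js ks len by (simp add: all_increasing_def strict_sorted_iff distinct_card)
      ultimately have "set js = set ks" by (intro card_subset_eq) auto
      then have "js = ks" using js ks
        by (intro sorted_distinct_set_unique) (simp_all add: all_increasing_def strict_sorted_iff)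
      with False show False by simp
    qed
    then obtain j where "j \<in> set js" "j \<notin> set ks" by auto
    then obtain i where i: "i < length js" "js ! i \<notin> set ks" by (metis in_set_conv_nth)
    define n where "n = length ks"
    define M where "M = mat n n (\<lambda>(i, j). ip X (map ((!) es) js ! i) (map ((!) es) ks ! j))"
    have M: "M \<in> carrier_mat n n" by (simp add: M_def)
    have in_n: "i < n" using i len by (simp add: n_def)
    have ent: "M $$ (i, j) = 0" if "j < n" for j
    proof -
      have "ks ! j \<in> set ks" using that by (simp add: n_def)
      then have "ks ! j \<noteq> js ! i" "ks ! j < length es" using i ks by (auto simp: all_increasing_def)
      moreover have "js ! i < length es"
        using nth_mem[OF i(1)] js unfolding all_increasing_def by blast
      ultimately have "ip X (es ! (js ! i)) (es ! (ks ! j)) = 0"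
        using on by (subst orthonormal_nth) auto
      then show ?thesis using that in_n len by (simp add: M_def n_def)
    qed
    have "det M = 0"
      by (subst laplace_expansion_row[OF M in_n]) (simp add: ent)
    then show ?thesis by (simp add: gram_def M_def n_def len)
  qed (simp add: gram_def)
  with False show ?thesis by simp
qed

section \<open>Fourier expansion in the exterior algebra\<close>

lemma free_ip_cong_right: "cls x = cls y \<Longrightarrow> free_ip X z x = free_ip X z y"
  using ext_ip_class[of z x] ext_ip_class[of z y] by simp

lemma free_ip_cong_left: "cls x = cls y \<Longrightarrow> free_ip X x z = free_ip X y z"
  using ext_ip_class[of x z] ext_ip_class[of y z] by simp

lemma free_ip_subword:
  assumes "orthonormal es" "js \<in> all_increasing (length es)" "ks \<in> all_increasing (length es)"
  shows "free_ip X (subword es js) (subword es ks) = (if js = ks then 1 else 0)"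
  by (simp only: subword_def free_ip_word gram_map_nth[OF assms])

lemma free_ip_subword_sum:
  assumes "orthonormal es" "S \<subseteq> all_increasing (length es)" "js \<in> S"
  shows "free_ip X (subword es js) (\<Sum>ks\<in>S. const (c ks) * subword es ks) = c js"
proof -
  have fin: "finite S" using assms(2) finite_all_increasing by (rule finite_subset)
  have "free_ip X (subword es js) (\<Sum>ks\<in>S. const (c ks) * subword es ks) =
      (\<Sum>ks\<in>S. if js = ks then c ks else 0)"
    unfolding free_ip_sum_right free_ip_const_right
    using assms(2,3) by (intro sum.cong refl, subst free_ip_subword[OF assms(1)]) auto
  then show ?thesis using fin assms(3) by simp
qed

lemma spanned_all:
  assumes "vs.span (set es) = UNIV"
  shows "spanned X es (all_increasing (length es)) x"
proof (induction x rule: free_alg_induct)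
  case (add c ws x)
  let ?m = "length es"
  have w: "spanned X es (increasing ?m (length ws)) (word ws)"
    using assms by (intro spanned_word) simp
  have "spanned X es (all_increasing ?m) (word ws)"
    using w increasing_subset finite_all_increasing by (rule spanned_mono)
  then show ?case using add by (intro spanned_add spanned_const)
qed (rule spanned_0)

text \<open>
  The wedge products of the sublists of an orthonormal basis are an orthonormal basis of the exterior
  algebra.  Nondegeneracy, Bessel's inequality and the existence of contractions follow.
\<close>

lemma fourier_expansion:
  assumes "orthonormal es" "vs.span (set es) = UNIV"
  shows "cls x = cls (\<Sum>js\<in>all_increasing (length es).
    const (free_ip X (subword es js) x) * subword es js)"
proof -
  let ?S = "all_increasing (length es)"
  from spanned_all[OF assms(2)] obtain c
    where c: "cls x = cls (\<Sum>js\<in>?S. const (c js) * subword es js)"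
    by (auto simp: spanned_def)
  have "free_ip X (subword es js) x = c js" if "js \<in> ?S" for js
    unfolding free_ip_cong_right[OF c] using assms(1) that by (intro free_ip_subword_sum) auto
  then show ?thesis unfolding c by simp
qed

lemma orthonormal_basis:
  obtains es where "orthonormal es" "vs.span (set es) = UNIV"
  using orthonormal_extend_basis[of "[]"] by (auto simp: orthonormal_def)

lemma nondegenerate_orthonormal:
  assumes "\<And>fs. orthonormal fs \<Longrightarrow> free_ip X (word fs) x = 0"
  shows "cls x = cls 0"
proof -
  obtain es where es: "orthonormal es" "vs.span (set es) = UNIV" by (rule orthonormal_basis)
  have "free_ip X (subword es js) x = 0" if "js \<in> all_increasing (length es)" for js
    unfolding subword_def using that
    by (intro assms orthonormal_map_nth[OF es(1)])
      (auto simp: all_increasing_def strict_sorted_iff)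
  then show ?thesis by (subst fourier_expansion[OF es]) simp
qed

text \<open>
  For a unit element \<open>x\<close> this bounds the inner product with an orthonormal wedge product by one, which
  is the instance of the Cauchy-Schwarz inequality needed to see that the cosine of the asymmetric
  angle is at most one.
\<close>

lemma bessel:
  assumes "orthonormal fs"
  shows "(norm (free_ip X (word fs) x))\<^sup>2 \<le> norm (free_ip X x x)"
proof -
  obtain gs where es: "orthonormal (fs @ gs)" "vs.span (set (fs @ gs)) = UNIV"
    using orthonormal_extend_basis[OF assms] .
  let ?es = "fs @ gs"
  let ?S = "all_increasing (length ?es)"
  define c where "c js = free_ip X (subword ?es js) x" for js
  have exp: "cls x = cls (\<Sum>js\<in>?S. const (c js) * subword ?es js)"
    unfolding c_def by (rule fourier_expansion[OF es])
  have "free_ip X x x = (\<Sum>js\<in>?S. c js * free_ip X x (subword ?es js))"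
    unfolding free_ip_cong_right[OF exp] by (simp add: free_ip_sum_right free_ip_const_right)
  also have "\<dots> = (\<Sum>js\<in>?S. of_real ((norm (c js))\<^sup>2))"
    by (intro sum.cong refl, subst free_ip_conjugate)
      (simp add: c_def[symmetric] mult_conjugate_self_of_real)
  also have "\<dots> = of_real (\<Sum>js\<in>?S. (norm (c js))\<^sup>2)" by simp
  finally have "norm (free_ip X x x) = (\<Sum>js\<in>?S. (norm (c js))\<^sup>2)"
    by (simp only: norm_of_real) (simp add: sum_nonneg)
  moreover have "[0..<length fs] \<in> ?S"
    by (auto simp: all_increasing_def strict_sorted_iff)
  then have "(norm (c [0..<length fs]))\<^sup>2 \<le> (\<Sum>js\<in>?S. (norm (c js))\<^sup>2)"
    by (intro member_le_sum) (auto simp: finite_all_increasing)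
  moreover have "map ((!) ?es) [0..<length fs] = fs"
    by (rule nth_equalityI) (simp_all add: nth_append)
  then have "subword ?es [0..<length fs] = (word fs :: 'v tword \<Rightarrow>\<^sub>0 'k)"
    by (simp only: subword_def)
  ultimately show ?thesis by (simp add: c_def)
qed

section \<open>Contraction\<close>

text \<open>
  Contraction by \<open>m\<close> is the adjoint of left multiplication by \<open>m\<close>; in an orthonormal basis of the
  exterior algebra its Fourier coefficients are prescribed.
\<close>

lemma contraction_exists:
  obtains k where "\<And>l. free_ip X l k = free_ip X (m * l) x"
proof -
  obtain es where es: "orthonormal es" "vs.span (set es) = UNIV" by (rule orthonormal_basis)
  let ?S = "all_increasing (length es)"
  define k where "k = (\<Sum>js\<in>?S. const (free_ip X (m * subword es js) x) * subword es js)"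
  have "free_ip X l k = free_ip X (m * l) x" for l
  proof -
    let ?c = "\<lambda>js. free_ip X (subword es js) l"
    have "cls (m * l) = cls (m * (\<Sum>js\<in>?S. const (?c js) * subword es js))"
      by (intro cls_mult refl fourier_expansion[OF es])
    then have "free_ip X (m * l) x =
        free_ip X (m * (\<Sum>js\<in>?S. const (?c js) * subword es js)) x"
      by (rule free_ip_cong_left)
    also have "\<dots> = (\<Sum>js\<in>?S. free_ip X (m * subword es js) x * free_ip X l (subword es js))"
      by (simp add: sum_distrib_left const_left_commute free_ip_sum_left free_ip_const_left
          free_ip_conjugate[symmetric] mult.commute)
    also have "\<dots> = free_ip X l k"
      by (simp add: k_def free_ip_sum_right free_ip_const_right)
    finally show ?thesis by simp
  qed
  then show ?thesis by (rule that)
qed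

lemma lcontr_eqI:
  assumes "\<And>l. free_ip X l k = free_ip X (m * l) x"
  shows "lcontr X (cls m) (cls x) = cls k"
  unfolding lcontr_def
proof (rule the_equality)
  show "cls k \<in> carrier (exterior X) \<and>
    (\<forall>L\<in>carrier (exterior X). ext_ip X L (cls k) = ext_ip X (cls m \<and>\<^bsub>X\<^esub> L) (cls x))"
    by (auto simp: carrier_exterior wedge_class ext_ip_class assms)
next
  fix K assume "K \<in> carrier (exterior X) \<and>
    (\<forall>L\<in>carrier (exterior X). ext_ip X L K = ext_ip X (cls m \<and>\<^bsub>X\<^esub> L) (cls x))"
  then obtain k' where k': "K = cls k'" "\<And>l. free_ip X l k' = free_ip X (m * l) x"
    by (auto simp: carrier_exterior wedge_class ext_ip_class)
  have "cls (k' - k) = cls 0"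
    by (rule nondegenerate_orthonormal) (simp add: free_ip_diff_right assms k')
  then show "K = cls k" by (simp add: k' ext_class_eq_iff)
qed

lemma lcontr_obtain:
  obtains k where "lcontr X (cls m) (cls x) = cls k" "\<And>l. free_ip X l k = free_ip X (m * l) x"
  using contraction_exists[of m x] lcontr_eqI by metis

text \<open>
  Wedging with an orthonormal list on one side and removing that list from the other argument does not
  change the inner product: this is the block triangular Gram determinant.
\<close>

lemma free_ip_append_left:
  assumes "orthonormal (es @ fs)"
  shows "free_ip X (word es * x) (word (es @ fs)) = free_ip X x (word fs)"
proof (induction x rule: free_alg_induct)
  case (add c ls x)
  have "gram X (es @ ls) (es @ fs) = gram X ls fs"
    using assms by (subst gram_block_upper)
      (auto simp: orthonormal_append gram_orthonormal)
  with add show ?case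
    by (simp add: distrib_left free_ip_add_left const_left_commute free_ip_const_left
        flip: word_append)
qed simp

lemma free_ip_append_right:
  assumes "orthonormal (es @ fs)"
  shows "free_ip X (x * word fs) (word (es @ fs)) = free_ip X x (word es)"
proof (induction x rule: free_alg_induct)
  case (add c ls x)
  have "gram X (ls @ fs) (es @ fs) = gram X ls es"
    using assms by (subst gram_block_lower)
      (auto simp: orthonormal_append gram_orthonormal ip_eq_0_commute)
  with add show ?case
    by (simp add: distrib_right free_ip_add_left mult.assoc free_ip_const_left
        flip: word_append)
qed simp

text \<open>
  The contraction is conjugate-linear in its left argument, hence \<open>conjugate a\<close>.
\<close>

lemma lcontr_word:
  assumes "orthonormal (es @ fs)"
  shows "lcontr X (cls (const a * word es)) (cls (const b * word (es @ fs))) =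
    cls (const (conjugate a * b) * word fs)"
  by (rule lcontr_eqI)
    (simp add: mult.assoc free_ip_const_left free_ip_const_right free_ip_append_left[OF assms])

section \<open>Norm, orientation and the star operator\<close>

lemma ext_norm_class: "ext_norm X (cls x) = sqrt (norm (free_ip X x x))"
  by (simp add: ext_norm_def ext_ip_class)

lemma ext_norm_const: "ext_norm X (cls (const a * x)) = norm a * ext_norm X (cls x)"
proof -
  have "norm (free_ip X (const a * x) (const a * x)) = (norm a)\<^sup>2 * norm (free_ip X x x)"
    by (simp add: free_ip_const_left free_ip_const_right norm_mult power2_eq_square)
  then show ?thesis by (simp add: ext_norm_class real_sqrt_mult)
qed

lemma ext_norm_orthonormal: "orthonormal es \<Longrightarrow> ext_norm X (cls (word es)) = 1"
  by (simp add: ext_norm_class gram_orthonormal)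

lemma const_word_eq_0_iff:
  assumes "orthonormal es"
  shows "cls (const a * word es) = cls 0 \<longleftrightarrow> a = 0"
proof
  assume "cls (const a * word es) = cls 0"
  then have "free_ip X (word es) (const a * word es) = 0"
    using free_ip_cong_right[of "const a * word es" 0 "word es"] by simp
  then show "a = 0" by (simp add: free_ip_const_right gram_orthonormal[OF assms])
qed simp

lemma const_word_cancel:
  assumes "orthonormal es" "cls (const a * word es) = cls (const b * word es)"
  shows "a = b"
  using free_ip_cong_right[OF assms(2), of "word es"] assms(1)
  by (simp add: free_ip_const_right gram_orthonormal)

lemma poly_mapping_sum_words:
  "x = (\<Sum>u\<in>Poly_Mapping.keys x. const (Poly_Mapping.lookup x u) * word (letters u))"
  for x :: "'v tword \<Rightarrow>\<^sub>0 'k"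
  by (rule poly_mapping_eqI)
    (simp add: lookup_sum word_def mult_single lookup_single when_def in_keys_iff)

text \<open>
  The top exterior power is a line, so the orientation is a phase times the wedge product of any
  orthonormal basis.
\<close>

lemma orientation_class:
  assumes "is_orientation X \<Omega>" "orthonormal es" "vs.span (set es) = UNIV"
  obtains w where "norm w = 1" "\<Omega> = cls (const w * word es)"
proof -
  from assms(1) obtain x where x: "\<Omega> = cls x"
    "\<forall>u\<in>Poly_Mapping.keys x. length (letters u) = length es" and nrm: "ext_norm X \<Omega> = 1"
    by (auto simp: is_orientation_def ext_power_def orthonormal_basis_length[OF assms(2,3)])
  have "spanned X es (increasing (length es) (length es))
     (\<Sum>u\<in>Poly_Mapping.keys x. const (Poly_Mapping.lookup x u) * word (letters u))"
  proof (intro spanned_sum spanned_const)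
    fix u assume "u \<in> Poly_Mapping.keys x"
    then have "length (letters u) = length es" using x(2) by blast
    then show "spanned X es (increasing (length es) (length es)) (word (letters u))"
      using spanned_word[of "letters u" es] assms(3) by simp
  qed
  then have "spanned X es (increasing (length es) (length es)) x"
    by (simp flip: poly_mapping_sum_words)
  then obtain w where w: "\<Omega> = cls (const w * word es)"
    by (auto simp: x(1) spanned_def increasing_full subword_full)
  with nrm have "norm w = 1"
    by (simp add: ext_norm_const ext_norm_orthonormal[OF assms(2)])
  with w show ?thesis by (rule that[rotated])
qed

text \<open>
  The difference of two elements with the same star is tested against an orthonormal wedge product
  \<open>word fs\<close>: with \<open>fs\<close> completed by \<open>gs\<close> to a basis, \<open>\<langle>z, word fs\<rangle>\<close> is up to a phase
  \<open>\<langle>z \<and> word gs, \<Omega>\<rangle> = \<langle>word gs, z\<^sup>\<star>\<rangle>\<close>.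
\<close>

lemma star_inj:
  assumes or: "is_orientation X \<Omega>" and eq: "star X \<Omega> (cls x) = star X \<Omega> (cls y)"
  shows "cls x = cls y"
proof -
  from or obtain o' where o: "\<Omega> = cls o'" by (auto simp: is_orientation_def ext_power_def)
  obtain kx where kx: "star X \<Omega> (cls x) = cls kx" "\<And>l. free_ip X l kx = free_ip X (x * l) o'"
    unfolding star_def o using lcontr_obtain[of x o'] by blast
  obtain ky where ky: "star X \<Omega> (cls y) = cls ky" "\<And>l. free_ip X l ky = free_ip X (y * l) o'"
    unfolding star_def o using lcontr_obtain[of y o'] by blast
  have xy: "free_ip X (x * l) o' = free_ip X (y * l) o'" for l
    using free_ip_cong_right[of kx ky l] kx ky eq by simp
  have "cls (x - y) = cls 0"
  proof (rule nondegenerate_orthonormal)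
    fix fs assume fs: "orthonormal fs"
    then obtain gs where gs: "orthonormal (fs @ gs)" "vs.span (set (fs @ gs)) = UNIV"
      by (rule orthonormal_extend_basis)
    from orientation_class[OF or gs] obtain w
      where w: "norm w = 1" "\<Omega> = cls (const w * word (fs @ gs))" .
    have "free_ip X (z * word gs) o' = w * free_ip X z (word fs)" for z
      using free_ip_cong_right[of o' "const w * word (fs @ gs)" "z * word gs"] w(2) o
      by (simp add: free_ip_const_right free_ip_append_right[OF gs(1)])
    with xy[of "word gs"] w(1) have "free_ip X x (word fs) = free_ip X y (word fs)" by auto
    then have "free_ip X (word fs) x = free_ip X (word fs) y"
      by (metis free_ip_conjugate)
    then show "free_ip X (word fs) (x - y) = 0" by (simp add: free_ip_diff_right)
  qed
  then show ?thesis by (simp add: ext_class_eq_iff)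
qed

text \<open>
  In an orthonormal basis adapted to its space, the star of a blade is the wedge product of the
  complementary vectors, up to a scalar.
\<close>

lemma star_word:
  assumes "orthonormal (es @ fs)" "\<Omega> = cls (const w * word (es @ fs))"
  shows "star X \<Omega> (cls (const a * word es)) = cls (const (conjugate a * w) * word fs)"
  unfolding star_def assms(2) by (rule lcontr_word[OF assms(1)])

lemma regr_eqI:
  assumes "is_orientation X \<Omega>" "star X \<Omega> (cls r) = star X \<Omega> A \<and>\<^bsub>X\<^esub> star X \<Omega> B"
  shows "regr X \<Omega> A B = cls r"
  unfolding regr_def
proof (rule the_equality)
  show "cls r \<in> carrier (exterior X) \<and> star X \<Omega> (cls r) = star X \<Omega> A \<and>\<^bsub>X\<^esub> star X \<Omega> B"
    by (simp add: assms(2))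
next
  fix R assume "R \<in> carrier (exterior X) \<and> star X \<Omega> R = star X \<Omega> A \<and>\<^bsub>X\<^esub> star X \<Omega> B"
  then obtain x where "R = cls x" "star X \<Omega> (cls x) = star X \<Omega> (cls r)"
    by (auto simp: carrier_exterior assms(2))
  with star_inj[OF assms(1)] show "R = cls r" by blast
qed

section \<open>Blades\<close>

text \<open>
  A nonzero blade determines its space as the set of the vectors whose exterior product with it
  vanishes.  If \<open>v\<close> has a nonzero component \<open>w\<close> orthogonal to \<open>es\<close>, then the inner product of
  \<open>w \<and> es\<close> and \<open>v \<and> es\<close> is \<open>\<langle>w, v\<rangle> = \<langle>w, w\<rangle> \<noteq> 0\<close>.
\<close>

lemma annihilator_word:
  assumes "orthonormal es" "a \<noteq> 0"
  shows "cls (gen v * (const a * word es)) = cls 0 \<longleftrightarrow> v \<in> vs.span (set es)"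
proof
  assume "v \<in> vs.span (set es)"
  then have "cls (word (v # es)) = cls 0"
    by (intro word_eq_0[of _ es]) (auto simp: vs.span_base)
  then have "cls (const a * word (v # es)) = cls (const a * 0)"
    by (intro cls_mult refl)
  then show "cls (gen v * (const a * word es)) = cls 0"
    by (simp add: word_Cons const_left_commute)
next
  assume 0: "cls (gen v * (const a * word es)) = cls 0"
  define w where "w = v - orth_proj es v"
  have w: "w \<in> perp X (vs.span (set es))"
    unfolding w_def by (rule orth_proj_residual[OF assms(1)])
  have "gram X ([w] @ es) ([v] @ es) = ip X w v"
  proof (subst gram_block_upper)
    show "ip X x d = 0" if "x \<in> set [w]" "d \<in> set es" for x d
      using that w by (auto simp: perp_iff intro: ip_eq_0_commute)
  qed (simp_all add: gram_orthonormal[OF assms(1)], simp add: gram_def det_single)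
  moreover have "free_ip X (word (w # es)) (gen v * (const a * word es)) = 0"
    using free_ip_cong_right[OF 0] by simp
  then have "a * gram X (w # es) (v # es) = 0"
    by (simp add: const_left_commute free_ip_const_right flip: word_Cons)
  ultimately have "ip X w v = 0" using assms(2) by simp
  moreover have "ip X (orth_proj es v) w = 0"
    using w orth_proj_in_span[of es v] by (auto simp: perp_def)
  then have "ip X w (orth_proj es v) = 0" by (rule ip_eq_0_commute)
  ultimately have "ip X w w = 0" by (simp add: w_def ip_diff_right)
  then have "w = 0" by (rule ip_self_eq_0)
  then show "v \<in> vs.span (set es)" using orth_proj_in_span[of es v] by (simp add: w_def)
qed

text \<open>
  An orthonormal basis of the span has at most as many members as the list; if it had fewer, the wedge
  product of the list would vanish.
\<close>

lemma wedge_list_orthonormal: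
  assumes "cls (word us) \<noteq> cls 0"
  obtains es a where "orthonormal es" "length es = length us" "a \<noteq> 0"
    "cls (word us) = cls (const a * word es)" "vs.span (set es) = vs.span (set us)"
proof -
  obtain es where es: "orthonormal es" "vs.span (set es) = vs.span (set us)"
    by (rule orthonormal_span_basis)
  have sub: "set us \<subseteq> vs.span (set es)" "set es \<subseteq> vs.span (set us)"
    using vs.span_superset[of "set us"] vs.span_superset[of "set es"] es(2) by auto
  have "length es = length us"
    using orthonormal_length_le[OF es(1) sub(2)] word_eq_0[OF sub(1)] assms by linarith
  moreover from word_proportional[OF sub(1) this[symmetric]] obtain a
    where a: "cls (word us) = cls (const a * word es)" .
  moreover have "a \<noteq> 0"
    using assms unfolding a by (metis single_zero mult_zero_left)
  ultimately show ?thesis using es by (intro that)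
qed

text \<open>
  The definition of \<open>blade_space\<close> asks for an unscaled wedge product, so \<open>a\<close> is absorbed into the
  first vector; that all admissible lists have the same span is \<open>annihilator_word\<close>.
\<close>

lemma blade_space_word:
  assumes "orthonormal es" "a \<noteq> 0"
  shows "blade_space X (cls (const a * word es)) = vs.span (set es)"
  unfolding blade_space_def
proof (rule the_equality)
  let ?B = "cls (const a * word es)"
  show "(\<exists>us. us \<noteq> [] \<and> ?B = wedge_list X us \<and> vs.span (set es) = vs.span (set us)) \<or>
    (\<exists>c. ?B = ext_scalar X c \<and> vs.span (set es) = {0})"
  proof (cases es)
    case Nil
    then show ?thesis by (auto simp: ext_scalar_def word_Nil)
  next
    case (Cons e fs)
    have "cls (word (scl X a e # fs)) = cls ((const a * gen e) * word fs)"
      unfolding word_Cons by (intro cls_mult cls_gen_scl refl)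
    then have "?B = wedge_list X (scl X a e # fs)"
      by (simp add: wedge_list_class Cons word_Cons mult.assoc)
    moreover have "vs.span (set es) = vs.span (set (scl X a e # fs))"
    proof (rule vs.span_eq[THEN iffD2], rule conjI)
      have "scl X a e \<in> vs.span (set (scl X a e # fs))" by (simp add: vs.span_base)
      then have "scl X (inverse a) (scl X a e) \<in> vs.span (set (scl X a e # fs))"
        by (rule vs.span_scale)
      then have "e \<in> vs.span (set (scl X a e # fs))" using assms(2) by simp
      then show "set es \<subseteq> vs.span (set (scl X a e # fs))"
        using Cons by (auto simp: vs.span_base)
      show "set (scl X a e # fs) \<subseteq> vs.span (set es)"
        using Cons by (auto simp: vs.span_base vs.span_scale)
    qed
    ultimately show ?thesis by blast
  qed
next
  let ?B = "cls (const a * word es)"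
  have uniq: "vs.span (set fs) = vs.span (set es)"
    if "orthonormal fs" "b \<noteq> 0" "?B = cls (const b * word fs)" for fs b
  proof -
    have "cls (gen v * (const a * word es)) = cls (gen v * (const b * word fs))" for v
      by (intro cls_mult refl that(3))
    then have "v \<in> vs.span (set es) \<longleftrightarrow> v \<in> vs.span (set fs)" for v
      using annihilator_word[OF assms, of v] annihilator_word[OF that(1,2), of v] by simp
    then show ?thesis by blast
  qed
  have B0: "?B \<noteq> cls 0" using const_word_eq_0_iff[OF assms(1)] assms(2) by simp
  fix V assume "(\<exists>us. us \<noteq> [] \<and> ?B = wedge_list X us \<and> V = vs.span (set us)) \<or>
    (\<exists>c. ?B = ext_scalar X c \<and> V = {0})"
  then show "V = vs.span (set es)"
  proof (elim disjE exE conjE)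
    fix us assume us: "?B = wedge_list X us" "V = vs.span (set us)"
    then have "cls (word us) \<noteq> cls 0" using B0 by (simp add: wedge_list_class)
    from wedge_list_orthonormal[OF this] us uniq show ?thesis
      by (metis wedge_list_class)
  next
    fix c assume c: "?B = ext_scalar X c" "V = {0}"
    then have "?B = cls (const c * word [])" by (simp add: ext_scalar_def word_Nil)
    moreover from this B0 have "c \<noteq> 0" by (metis single_zero mult_zero_left)
    moreover have "orthonormal []" by (simp add: orthonormal_def)
    ultimately show ?thesis using uniq[of "[]" c] c(2) by simp
  qed
qed

text \<open>
  The normal form in which all blades are handled.  It covers the scalars with \<open>es = []\<close>.
\<close>

lemma nonzero_blade:
  assumes "is_blade X p B" "B \<noteq> cls 0"
  obtains es a where "orthonormal es" "length es = p" "a \<noteq> 0"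
    "B = cls (const a * word es)" "blade_space X B = vs.span (set es)"
proof (cases "p = 0")
  case True
  with assms(1) obtain c where c: "B = cls (const c * word [])"
    by (auto simp: is_blade_def ext_scalar_def word_Nil)
  moreover from c assms(2) have "c \<noteq> 0" by (metis single_zero mult_zero_left)
  moreover have "orthonormal []" by (simp add: orthonormal_def)
  ultimately show ?thesis using that[of "[]" c] blade_space_word[of "[]" c] True by simp
next
  case False
  with assms(1) obtain us where us: "length us = p" "B = cls (word us)"
    by (auto simp: is_blade_def wedge_list_class)
  from wedge_list_orthonormal[of us] assms(2) us obtain es a where
    "orthonormal es" "length es = length us" "a \<noteq> 0" "cls (word us) = cls (const a * word es)"
    by metis
  then show ?thesis using us that[of es a] blade_space_word[of es a] by simp
qed

lemma is_blade_word: "is_blade X (length es) (cls (const a * word es))"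
proof (cases es)
  case Nil
  then show ?thesis by (auto simp: is_blade_def ext_scalar_def word_Nil)
next
  case (Cons e fs)
  have "cls (word (scl X a e # fs)) = cls ((const a * gen e) * word fs)"
    unfolding word_Cons by (intro cls_mult cls_gen_scl refl)
  then have "cls (const a * word es) = wedge_list X (scl X a e # fs)"
    by (simp add: wedge_list_class Cons word_Cons mult.assoc)
  then show ?thesis using Cons unfolding is_blade_def
    by (metis length_Cons nat.distinct(1))
qed

text \<open>
  The list has as many members as an orthonormal basis inside its span.  The wedge product of that
  basis is then a multiple of the wedge product of the list, and it is not zero.
\<close>

lemma word_nonzero:
  assumes "orthonormal es" "length es = length us" "set es \<subseteq> vs.span (set us)"
  shows "cls (word us) \<noteq> cls 0"
proof
  assume 0: "cls (word us) = cls 0"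
  from word_proportional[OF assms(3,2)] obtain c where "cls (word es) = cls (const c * word us)" .
  also have "\<dots> = cls (const c * 0)" by (intro cls_mult refl 0)
  finally have "cls (const 1 * word es) = cls 0" by simp
  then show False using const_word_eq_0_iff[OF assms(1), of 1] by simp
qed

end


section \<open>Outermorphisms\<close>

text \<open>
  The free algebra is free on a set, so any map of the vectors extends to a homomorphism; if the map is
  linear, the homomorphism preserves the ideal and induces the outermorphism.
\<close>

definition map_words :: "('v \<Rightarrow> 'v) \<Rightarrow> ('v tword \<Rightarrow>\<^sub>0 'k::comm_ring_1) \<Rightarrow> ('v tword \<Rightarrow>\<^sub>0 'k)" where
  "map_words f x = (\<Sum>u\<in>Poly_Mapping.keys x.
     const (Poly_Mapping.lookup x u) * word (map f (letters u)))"

lemma map_words_superset: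
  assumes "finite U" "Poly_Mapping.keys x \<subseteq> U"
  shows "map_words f x = (\<Sum>u\<in>U. const (Poly_Mapping.lookup x u) * word (map f (letters u)))"
  unfolding map_words_def
  using assms by (intro sum.mono_neutral_left) (auto simp: in_keys_iff)

lemma map_words_add: "map_words f (x + y) = map_words f x + map_words f y"
  for x y :: "'a tword \<Rightarrow>\<^sub>0 'b::comm_ring_1"
proof -
  let ?U = "Poly_Mapping.keys x \<union> Poly_Mapping.keys y"
  have "map_words f z = (\<Sum>u\<in>?U. const (Poly_Mapping.lookup z u) * word (map f (letters u)))"
    if "Poly_Mapping.keys z \<subseteq> ?U" for z :: "'a tword \<Rightarrow>\<^sub>0 'b"
    by (rule map_words_superset) (use that in auto)
  then show ?thesis
    using Poly_Mapping.keys_add[of x y]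
    by (simp add: lookup_add const_add distrib_right sum.distrib)
qed

lemma map_words_0 [simp]: "map_words f 0 = 0"
  by (simp add: map_words_def)

lemma map_words_const: "map_words f (const c * x) = const c * map_words f x"
proof -
  have "map_words f (const c * x) = (\<Sum>u\<in>Poly_Mapping.keys x.
      const (Poly_Mapping.lookup (const c * x) u) * word (map f (letters u)))"
    by (rule map_words_superset) (use keys_const_mult in auto)
  then show ?thesis
    by (simp add: map_words_def lookup_const_mult sum_distrib_left mult.assoc
        flip: const_mult_const)
qed

lemma map_words_word: "map_words f (word us) = word (map f us)"
  by (simp add: map_words_def) (simp add: word_def)

lemma map_words_uminus: "map_words f (- x) = - map_words f x"
  using map_words_add[of f x "- x"] by (simp add: eq_neg_iff_add_eq_0 add.commute)

lemma map_words_diff: "map_words f (x - y) = map_words f x - map_words f y"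
  using map_words_add[of f x "- y"] by (simp add: map_words_uminus)

lemma map_words_mult: "map_words f (x * y) = map_words f x * map_words f y"
  for x y :: "'a tword \<Rightarrow>\<^sub>0 'b::comm_ring_1"
proof (induction x rule: free_alg_induct)
  case (add c us x)
  have "map_words f (word us * y) = word (map f us) * map_words f y"
  proof (induction y rule: free_alg_induct)
    case (add d ws y)
    have "map_words f (word us * word ws) = (word (map f us) * word (map f ws) :: 'a tword \<Rightarrow>\<^sub>0 'b)"
      by (simp add: map_words_word flip: word_append)
    with add show ?case
      by (simp add: map_words_add map_words_const map_words_word
          distrib_left const_left_commute)
  qed simp
  with add show ?case
    by (simp add: distrib_right map_words_add map_words_const map_words_word mult.assoc)
qed simp

context fin_inner_space
begin

lemma map_words_ideal:
  assumes lin: "\<And>a b v w. f (scl X a v + scl X b w) = scl X a (f v) + scl X b (f w)"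
    and x: "x \<in> ext_ideal X"
  shows "map_words f x \<in> ext_ideal X"
proof -
  let ?J = "{x. map_words f x \<in> ext_ideal X}"
  have gen: "map_words f (gen v) = gen (f v)" for v
    by (simp only: gen_eq_word map_words_word list.map)
  have "ext_ideal X \<subseteq> ?J"
  proof (rule ext_ideal_subset)
    show "ideal ?J free_alg"
      by (rule ideal_free_algI)
        (simp_all add: map_words_add map_words_mult ext_ideal_0 ext_ideal_add
          ext_ideal_lmult ext_ideal_rmult)
  next
    fix a b v w
    show "gen (scl X a v + scl X b w) - (const a * gen v + const b * gen w) \<in> ?J"
      using ext_ideal_linear[of X a "f v" b "f w"]
      by (simp add: map_words_diff map_words_add map_words_const gen lin)
  next
    show "gen v * gen v \<in> ?J" for v
      by (simp add: map_words_mult gen ext_ideal_square)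
  qed
  with x show ?thesis by blast
qed

lemma outermorphism_exists:
  assumes lin: "\<And>a b v w. f (scl X a v + scl X b w) = scl X a (f v) + scl X b (f w)"
  obtains F where "outermorphism X F" "\<And>v. F (ext_vec X v) = ext_vec X (f v)"
proof -
  define F where "F M = cls (map_words f (SOME x. x \<in> M))" for M
  have F: "F (cls x) = cls (map_words f x)" for x
  proof -
    have "x \<in> cls x" using ext_ideal_0 by (force simp: ext_class_eq)
    then have "(SOME z. z \<in> cls x) \<in> cls x" by (rule someI)
    then have "(SOME z. z \<in> cls x) - x \<in> ext_ideal X" by (auto simp: ext_class_eq)
    from map_words_ideal[OF lin this] show ?thesis
      by (simp add: F_def ext_class_eq_iff map_words_diff)
  qed
  have one: "map_words f 1 = 1"
    using map_words_word[of f "[]"] by (simp add: word_Nil)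
  have "F \<in> Ring.ring_hom (exterior X) (exterior X)"
    by (rule ring_hom_memI)
      (auto simp: carrier_exterior wedge_class add_exterior one_exterior F map_words_mult
        map_words_add one)
  moreover have "F (ext_scl X c M) = ext_scl X c (F M)" if "M \<in> carrier (exterior X)" for c M
    using that by (auto simp: carrier_exterior ext_scl_class F map_words_const)
  moreover have "F (ext_vec X v) = ext_vec X (f v)" for v
    by (simp add: ext_vec_def F) (simp add: gen_eq_word map_words_word)
  ultimately show ?thesis by (intro that) (auto simp: outermorphism_def)
qed

text \<open>
  The defining choice is met because an outermorphism extending \<open>f\<close> exists; on wedge products of
  vectors all of them agree.
\<close>

lemma outer_ext_word:
  assumes lin: "\<And>a b v w. f (scl X a v + scl X b w) = scl X a (f v) + scl X b (f w)"
  shows "outer_ext X f (cls (const a * word us)) = cls (const a * word (map f us))"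
proof -
  define F where "F = outer_ext X f"
  obtain F' where F': "outermorphism X F'" "\<And>v. F' (ext_vec X v) = ext_vec X (f v)"
    using outermorphism_exists[of f] lin by metis
  have "outermorphism X F \<and> (\<forall>v. F (ext_vec X v) = ext_vec X (f v))"
    unfolding F_def outer_ext_def
    by (rule someI[of _ F']) (simp add: F')
  then have hom: "F \<in> Ring.ring_hom (exterior X) (exterior X)"
    and scl: "F (ext_scl X c (cls x)) = ext_scl X c (F (cls x))"
    and vec: "F (cls (gen v)) = cls (gen (f v))" for c x v
    by (auto simp: outermorphism_def ext_vec_def)
  have "F (cls (word us)) = cls (word (map f us))"
  proof (induction us)
    case Nil
    show ?case using ring_hom_one[OF hom] by (simp add: one_exterior word_Nil)
  next
    case (Cons u us)
    have "F (cls (gen u) \<and>\<^bsub>X\<^esub> cls (word us)) = F (cls (gen u)) \<and>\<^bsub>X\<^esub> F (cls (word us))"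
      by (rule ring_hom_mult[OF hom]) simp_all
    then show ?case by (simp add: Cons.IH vec wedge_class word_Cons)
  qed
  then show ?thesis using scl[of a "word us"] by (simp add: ext_scl_class F_def)
qed

section \<open>The asymmetric angle\<close>

lemma orth_proj_linear:
  "orth_proj es (scl X a v + scl X b w) = scl X a (orth_proj es v) + scl X b (orth_proj es w)"
proof -
  have "orth_proj es (scl X a v + scl X b w) =
      (\<Sum>e\<in>set es. scl X a (scl X (ip X e v) e) + scl X b (scl X (ip X e w) e))"
    unfolding orth_proj_def
    by (intro sum.cong refl) (simp add: ip_add_right ip_scl_right vs.scale_left_distrib)
  then show ?thesis by (simp add: orth_proj_def sum.distrib vs.scale_sum_right)
qed

lemma proj_orthonormal:
  assumes "orthonormal es" shows "proj X (vs.span (set es)) = orth_proj es"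
proof
  fix x
  show "proj X (vs.span (set es)) x = orth_proj es x"
    unfolding proj_def
  proof (rule the_equality)
    show "orth_proj es x \<in> vs.span (set es) \<and> x - orth_proj es x \<in> perp X (vs.span (set es))"
      using orth_proj_in_span orth_proj_residual[OF assms] by simp
  next
    fix w assume w: "w \<in> vs.span (set es) \<and> x - w \<in> perp X (vs.span (set es))"
    have "w - orth_proj es x \<in> vs.span (set es)"
      using w orth_proj_in_span[of es x] by (simp add: vs.span_diff)
    moreover have "w - orth_proj es x \<in> perp X (vs.span (set es))"
      using w orth_proj_residual[OF assms, of x] by (simp add: perp_iff ip_diff_right)
    ultimately have "w - orth_proj es x = 0" by (rule span_inter_perp)
    then show "w = orth_proj es x" by simp
  qed
qed

text \<open>
  The component of a vector orthogonal to \<open>bs\<close> lies in the span of \<open>cs\<close>, and wedging with \<open>cs\<close>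
  kills it.
\<close>

lemma word_orth_proj_complement:
  assumes "orthonormal (bs @ cs)" "vs.span (set (bs @ cs)) = UNIV"
  shows "cls (word (us @ cs)) = cls (word (map (orth_proj bs) us @ cs))"
proof (induction us)
  case (Cons u us)
  let ?ws = "map (orth_proj bs) us @ cs"
  have bs: "orthonormal bs" using assms(1) by (simp add: orthonormal_append)
  have "u - orth_proj bs u \<in> vs.span (set cs)"
    using orth_proj_residual[OF bs] perp_span_orthonormal[OF assms] by simp
  then have "u - orth_proj bs u \<in> vs.span (set ?ws)"
    using vs.span_mono[of "set cs" "set ?ws"] by auto
  then have 0: "cls (word ((u - orth_proj bs u) # ?ws)) = cls 0"
    by (intro word_eq_0[of _ ?ws]) (auto simp: vs.span_base)
  have "cls (gen u * word (us @ cs)) = cls (gen ((u - orth_proj bs u) + orth_proj bs u) * word ?ws)"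
    by (simp only: diff_add_cancel) (intro cls_mult refl Cons.IH)
  also have "\<dots> = cls ((gen (u - orth_proj bs u) + gen (orth_proj bs u)) * word ?ws)"
    by (intro cls_mult refl cls_gen_add)
  also have "\<dots> = cls (word ((u - orth_proj bs u) # ?ws) + word (orth_proj bs u # ?ws))"
    by (simp add: distrib_right word_Cons)
  also have "\<dots> = cls (0 + word (orth_proj bs u # ?ws))"
    by (intro cls_add 0 refl)
  finally show ?case by (simp add: word_Cons)
qed simp

text \<open>
  After the projection the two groups of factors are orthogonal to each other, so the Gram determinant
  is a product.
\<close>

lemma ext_norm_orth_proj:
  assumes "orthonormal (bs @ cs)" "vs.span (set (bs @ cs)) = UNIV"
  shows "ext_norm X (cls (word (us @ cs))) = ext_norm X (cls (word (map (orth_proj bs) us)))"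
proof -
  let ?us = "map (orth_proj bs) us"
  have "ip X a d = 0" if "a \<in> set ?us" "d \<in> set cs" for a d
  proof -
    have "d \<in> perp X (vs.span (set bs))"
      using assms(1) that(2) by (simp add: perp_iff orthonormal_append)
    moreover have "a \<in> vs.span (set bs)" using that(1) orth_proj_in_span by auto
    ultimately show ?thesis by (simp add: perp_def)
  qed
  then have "gram X (?us @ cs) (?us @ cs) = gram X ?us ?us"
    using assms(1) by (subst gram_block_upper) (auto simp: orthonormal_append gram_orthonormal)
  then show ?thesis
    unfolding word_orth_proj_complement[OF assms, of us] by (simp add: ext_norm_class)
qed

text \<open>
  If the projected wedge product is \<open>m\<close> times an orthonormal one \<open>ds\<close>, then \<open>m\<close> is the inner product
  of \<open>ds\<close> with the original wedge product, because \<open>ds\<close> lies in the space projected onto; the latter is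
  a unit element.  Without this bound \<open>arccos\<close> could not be undone.
\<close>

lemma ext_norm_orth_proj_le_1:
  assumes "orthonormal us" "orthonormal bs"
  shows "ext_norm X (cls (word (map (orth_proj bs) us))) \<le> 1"
proof (cases "cls (word (map (orth_proj bs) us)) = cls 0")
  case True
  then show ?thesis by (simp add: ext_norm_class)
next
  case False
  let ?us = "map (orth_proj bs) us"
  from wedge_list_orthonormal[OF False] obtain ds m where ds: "orthonormal ds"
    "length ds = length ?us" "cls (word ?us) = cls (const m * word ds)"
    "vs.span (set ds) = vs.span (set ?us)" by metis
  have "set ?us \<subseteq> vs.span (set bs)" using orth_proj_in_span by auto
  then have "vs.span (set ?us) \<subseteq> vs.span (set bs)"
    by (simp add: vs.span_minimal vs.subspace_span)
  then have sub: "d \<in> vs.span (set bs)" if "d \<in> set ds" for d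
    using that ds(4) vs.span_base by blast
  have ipd: "ip X d (orth_proj bs u) = ip X d u" if "d \<in> set ds" for d u
    using orth_proj_residual[OF assms(2), of u] sub[OF that]
    by (auto simp: perp_def ip_diff_right)
  have "m = free_ip X (word ds) (word ?us)"
    using free_ip_cong_right[OF ds(3), of "word ds"]
    by (simp add: free_ip_const_right gram_orthonormal[OF ds(1)])
  also have "\<dots> = gram X ds us"
  proof -
    let ?n = "length us"
    have "mat ?n ?n (\<lambda>(i, j). ip X (ds ! i) (?us ! j)) = mat ?n ?n (\<lambda>(i, j). ip X (ds ! i) (us ! j))"
      using ds(2) by (intro eq_matI) (auto simp: ipd)
    then show ?thesis using ds(2) by (simp add: gram_def)
  qed
  finally have "(norm m)\<^sup>2 \<le> 1"
    using bessel[OF ds(1), of "word us"] by (simp add: gram_orthonormal[OF assms(1)])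
  then have "norm m \<le> 1" by (simp add: power_le_one_iff abs_square_le_1)
  then show ?thesis
    by (simp add: ds(3) ext_norm_const ext_norm_orthonormal[OF ds(1)])
qed

lemma ext_norm_nonneg: "0 \<le> ext_norm X M"
  by (simp add: ext_norm_def)

text \<open>
  The angle formula in the form in which the norm of \<open>A\<^sup>\<star> \<and> B\<^sup>\<star>\<close> produces it: here \<open>as\<close> spans
  \<open>[A]\<^sup>\<bottom>\<close>, \<open>bs\<close> spans \<open>[B]\<close> and \<open>cs\<close> spans \<open>[B]\<^sup>\<bottom>\<close>.
\<close>

lemma cos_asym_angle:
  assumes as: "orthonormal as" and bc: "orthonormal (bs @ cs)" "vs.span (set (bs @ cs)) = UNIV"
  shows "cos (asym_angle X (vs.span (set as)) (vs.span (set bs))) =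
    ext_norm X (cls (word (as @ cs)))"
proof -
  define C where "C = (SOME C. (\<exists>p. is_blade X p C) \<and> C \<noteq> \<zero>\<^bsub>exterior X\<^esub> \<and>
     blade_space X C = vs.span (set as))"
  have "(\<exists>p. is_blade X p C) \<and> C \<noteq> \<zero>\<^bsub>exterior X\<^esub> \<and> blade_space X C = vs.span (set as)"
    unfolding C_def
  proof (rule someI)
    let ?C = "cls (const 1 * word as)"
    show "(\<exists>p. is_blade X p ?C) \<and> ?C \<noteq> \<zero>\<^bsub>exterior X\<^esub> \<and> blade_space X ?C = vs.span (set as)"
      using is_blade_word const_word_eq_0_iff[OF as, of 1] blade_space_word[OF as, of 1]
      by (metis zero_exterior one_neq_zero)
  qed
  then obtain p where C: "is_blade X p C" "C \<noteq> cls 0" "blade_space X C = vs.span (set as)"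
    by (auto simp: zero_exterior)
  from nonzero_blade[OF C(1,2)] obtain es a where es: "orthonormal es" "a \<noteq> 0"
    "C = cls (const a * word es)" "vs.span (set es) = vs.span (set as)"
    using C(3) by metis
  have "set es \<subseteq> vs.span (set as)" using es(4) vs.span_superset by blast
  then obtain d where d: "cls (word es) = cls (const d * word as)"
    using word_proportional orthonormal_length_eq[OF es(1) as es(4)] by metis
  define c where "c = a * d"
  have "C = cls (const a * (const d * word as))"
    unfolding es(3) by (intro cls_mult refl d)
  then have C': "C = cls (const c * word as)"
    by (simp add: c_def mult.assoc flip: const_mult_const)
  have c0: "c \<noteq> 0" using C(2) C' const_word_eq_0_iff[OF as, of c] by simp
  have b: "orthonormal bs" using bc(1) by (simp add: orthonormal_append)
  have "ext_norm X (outer_ext X (proj X (vs.span (set bs))) C) =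
      norm c * ext_norm X (cls (word (map (orth_proj bs) as)))"
    unfolding proj_orthonormal[OF b] C' outer_ext_word[OF orth_proj_linear] ext_norm_const ..
  moreover have "ext_norm X C = norm c"
    by (simp add: C' ext_norm_const ext_norm_orthonormal[OF as])
  ultimately have "asym_angle X (vs.span (set as)) (vs.span (set bs)) =
      arccos (ext_norm X (cls (word (map (orth_proj bs) as))))"
    using c0 by (simp add: asym_angle_def C_def[symmetric])
  then have "cos (asym_angle X (vs.span (set as)) (vs.span (set bs))) =
      ext_norm X (cls (word (map (orth_proj bs) as)))"
    using ext_norm_orth_proj_le_1[OF as b] ext_norm_nonneg[of "cls (word (map (orth_proj bs) as))"]
    by (simp add: cos_arccos)
  then show ?thesis by (simp add: ext_norm_orth_proj[OF bc])
qed

end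


section \<open>The regressive product of two blades\<close>

context fin_inner_space
begin

lemma orthonormal_commute: "orthonormal (as @ bs) \<longleftrightarrow> orthonormal (bs @ as)"
  by (auto simp: orthonormal_append ip_eq_0_commute)

lemma perp_span_orthonormal':
  assumes "orthonormal (as @ bs)" "vs.span (set (as @ bs)) = UNIV"
  shows "perp X (vs.span (set bs)) = vs.span (set as)"
  using perp_span_orthonormal[of bs as] assms by (simp add: orthonormal_commute[of as] Un_commute)

text \<open>
  \<open>(V\<^sup>\<bottom> + W\<^sup>\<bottom>)\<^sup>\<bottom> = V \<inter> W\<close>, where \<open>V\<close> and \<open>W\<close> are the spans of \<open>as\<close> and \<open>bs\<close>.
\<close>

lemma perp_span_inter:
  assumes a: "orthonormal (as @ as')" "vs.span (set (as @ as')) = UNIV"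
    and b: "orthonormal (bs @ bs')" "vs.span (set (bs @ bs')) = UNIV"
    and c: "orthonormal (cs @ ds)" "vs.span (set (cs @ ds)) = UNIV"
    and cs: "vs.span (set cs) = vs.span (set (as' @ bs'))"
  shows "vs.span (set ds) = vs.span (set as) \<inter> vs.span (set bs)"
proof -
  have "vs.span (set ds) = perp X (vs.span (set (as' @ bs')))"
    using perp_span_orthonormal[OF c] cs by simp
  also have "\<dots> = perp X (vs.span (set as')) \<inter> perp X (vs.span (set bs'))"
    by (auto simp: perp_iff)
  finally show ?thesis
    by (simp add: perp_span_orthonormal'[OF a] perp_span_orthonormal'[OF b])
qed

lemma orthonormal_extend_to:
  assumes "orthonormal es" "vs.span (set es) \<subseteq> vs.span (set us)"
  obtains fs where "orthonormal (es @ fs)" "vs.span (set (es @ fs)) = vs.span (set us)"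
proof -
  from orthonormal_extend[OF assms(1), of us] obtain fs where
    fs: "orthonormal (es @ fs)" "vs.span (set (es @ fs)) = vs.span (set es \<union> set us)" by blast
  have "vs.span (set es \<union> set us) = vs.span (set us)"
    by (rule vs.span_eq[THEN iffD2])
      (use assms(2) vs.span_superset[of "set es"] vs.span_superset[of "set us"]
        vs.span_superset[of "set es \<union> set us"] in auto)
  with fs that show ?thesis by simp
qed

text \<open>
  A dimension count, with \<open>V\<close> and \<open>W\<close> the spans of \<open>as\<close> and \<open>bs\<close>.  Let \<open>ds\<close> be an orthonormal basis of \<open>V \<inter> W\<close>, completed to bases of \<open>V\<close> and
  of \<open>W\<close> by \<open>es\<close> and \<open>fs\<close>.  If \<open>V + W\<close> is everything, then \<open>ds @ es @ fs\<close> spans, which bounds the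
  dimension of \<open>V \<inter> W\<close> from above and that of its complement \<open>V\<^sup>\<bottom> + W\<^sup>\<bottom>\<close> from below by
  \<open>length (as' @ bs')\<close>.
\<close>

lemma complements_wedge_nonzero:
  assumes a: "orthonormal (as @ as')" "vs.span (set (as @ as')) = UNIV"
    and b: "orthonormal (bs @ bs')" "vs.span (set (bs @ bs')) = UNIV"
    and sum: "vs.span (set as \<union> set bs) = UNIV"
  shows "cls (word (as' @ bs')) \<noteq> cls 0"
proof -
  obtain cs where cs: "orthonormal cs" "vs.span (set cs) = vs.span (set (as' @ bs'))"
    by (rule orthonormal_span_basis)
  obtain ds where ds: "orthonormal (cs @ ds)" "vs.span (set (cs @ ds)) = UNIV"
    using orthonormal_extend_basis[OF cs(1)] .
  have int: "vs.span (set ds) = vs.span (set as) \<inter> vs.span (set bs)"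
    by (rule perp_span_inter[OF a b ds cs(2)])
  have d: "orthonormal ds" using ds(1) by (simp add: orthonormal_append)
  obtain es where es: "orthonormal (ds @ es)" "vs.span (set (ds @ es)) = vs.span (set as)"
    using orthonormal_extend_to[OF d, of as] int by auto
  obtain fs where fs: "orthonormal (ds @ fs)" "vs.span (set (ds @ fs)) = vs.span (set bs)"
    using orthonormal_extend_to[OF d, of bs] int by auto
  have on: "orthonormal as" "orthonormal bs" using a b by (auto simp: orthonormal_append)
  have len: "length ds + length es = length as" "length ds + length fs = length bs"
    using orthonormal_length_eq[OF es(1) on(1) es(2)] orthonormal_length_eq[OF fs(1) on(2) fs(2)]
    by simp_all
  have n: "length as + length as' = ips_dim X" "length bs + length bs' = ips_dim X"
    "length cs + length ds = ips_dim X"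
    using orthonormal_basis_length[OF a] orthonormal_basis_length[OF b]
      orthonormal_basis_length[OF ds] by simp_all
  have "vs.span (set (ds @ es @ fs)) = UNIV"
  proof -
    have "vs.span (set (ds @ es)) \<subseteq> vs.span (set (ds @ es @ fs))"
      "vs.span (set (ds @ fs)) \<subseteq> vs.span (set (ds @ es @ fs))"
      by (intro vs.span_mono; simp; blast)+
    then have "set as \<union> set bs \<subseteq> vs.span (set (ds @ es @ fs))"
      unfolding es(2) fs(2) using vs.span_superset[of "set as"] vs.span_superset[of "set bs"]
      by blast
    then have "vs.span (set as \<union> set bs) \<subseteq> vs.span (set (ds @ es @ fs))"
      by (simp add: vs.span_minimal vs.subspace_span)
    with sum show ?thesis by auto
  qed
  then have "length (cs @ ds) \<le> length (ds @ es @ fs)"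
    by (intro orthonormal_length_le ds) simp
  moreover have sub: "set cs \<subseteq> vs.span (set (as' @ bs'))"
    using cs(2) vs.span_superset by blast
  then have "length cs \<le> length (as' @ bs')"
    by (rule orthonormal_length_le[OF cs(1)])
  ultimately have "length cs = length (as' @ bs')"
    using len n by simp
  then show ?thesis by (rule word_nonzero[OF cs(1) _ sub])
qed

text \<open>
  A unit vector \<open>x\<close> orthogonal to \<open>V + W\<close> lies both in \<open>V\<^sup>\<bottom>\<close> and in \<open>W\<^sup>\<bottom>\<close>.  Taking it as the first
  member of a basis of \<open>W\<^sup>\<bottom>\<close> shows that one vector fewer suffices to span \<open>V\<^sup>\<bottom> + W\<^sup>\<bottom>\<close>.
\<close>

lemma complements_wedge_eq_0:
  assumes a: "orthonormal (as @ as')" "vs.span (set (as @ as')) = UNIV"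
    and b: "orthonormal (bs @ bs')" "vs.span (set (bs @ bs')) = UNIV"
    and sum: "vs.span (set as \<union> set bs) \<noteq> UNIV"
  shows "cls (word (as' @ bs')) = cls 0"
proof -
  obtain cs where cs: "orthonormal cs" "vs.span (set cs) = vs.span (set (as @ bs))"
    by (rule orthonormal_span_basis)
  obtain ds where ds: "orthonormal (cs @ ds)" "vs.span (set (cs @ ds)) = UNIV"
    using orthonormal_extend_basis[OF cs(1)] .
  have "ds \<noteq> []" using ds(2) cs(2) sum by auto
  then obtain x where x: "x \<in> set ds" by (cases ds) auto
  have int: "vs.span (set ds) = vs.span (set as') \<inter> vs.span (set bs')"
    by (rule perp_span_inter[of as' as bs' bs, OF _ _ _ _ ds cs(2)])
      (use a b in \<open>simp_all add: orthonormal_commute[of as'] orthonormal_commute[of bs'] Un_commute\<close>)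
  have xs: "orthonormal [x]" "x \<in> vs.span (set as')" "x \<in> vs.span (set bs')"
    using x int vs.span_base[OF x] ds(1) by (auto simp: orthonormal_append orthonormal_def)
  have "vs.span (set [x]) \<subseteq> vs.span (set bs')"
    using xs(3) by (intro vs.span_minimal) (auto simp: vs.subspace_span)
  from orthonormal_extend_to[OF xs(1) this] obtain gs
    where gs: "orthonormal ([x] @ gs)" "vs.span (set ([x] @ gs)) = vs.span (set bs')" .
  have "orthonormal bs'" using b by (simp add: orthonormal_append)
  from orthonormal_length_eq[OF gs(1) this gs(2)] have len: "Suc (length gs) = length bs'" by simp
  let ?T = "vs.span (set (as' @ gs))"
  have T: "vs.span (set as') \<subseteq> ?T" by (intro vs.span_mono) auto
  have "set ([x] @ gs) \<subseteq> ?T"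
    using T xs(2) vs.span_superset[of "set (as' @ gs)"] by auto
  then have "vs.span (set ([x] @ gs)) \<subseteq> ?T"
    by (simp add: vs.span_minimal vs.subspace_span)
  then have "set (as' @ bs') \<subseteq> ?T"
    using gs(2) T vs.span_superset[of "set as'"] vs.span_superset[of "set bs'"] by auto
  then show ?thesis by (rule word_eq_0) (simp flip: len)
qed

lemma lcontr_spec:
  assumes "lcontr X (cls m) (cls x) = cls k"
  shows "free_ip X l k = free_ip X (m * l) x"
  using assms lcontr_obtain[of m x] free_ip_cong_right by metis

lemma star_spec:
  assumes "star X (cls w) (cls x) = cls s"
  shows "free_ip X l s = free_ip X (x * l) w"
  using assms unfolding star_def by (rule lcontr_spec)

text \<open>
  The identity \<open>\<langle>M \<and> B\<^sup>\<star>, \<Omega>\<rangle> = \<langle>M, B\<rangle>\<close> for a blade \<open>B\<close>, here with representatives \<open>w\<close>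
  of \<open>\<Omega>\<close> and \<open>s\<close> of \<open>B\<^sup>\<star>\<close>.
\<close>

lemma free_ip_mult_star:
  assumes on: "orthonormal (bs @ bs')" and w: "cls w = cls (const d * word (bs @ bs'))" "norm d = 1"
    and s: "cls s = cls (const (conjugate b * d) * word bs')"
  shows "free_ip X (x * s) w = free_ip X x (const b * word bs)"
proof -
  have "cls (x * s) = cls (x * (const (conjugate b * d) * word bs'))"
    by (intro cls_mult refl s)
  then have "free_ip X (x * s) w =
      free_ip X (x * (const (conjugate b * d) * word bs')) (const d * word (bs @ bs'))"
    by (metis free_ip_cong_left free_ip_cong_right w(1))
  also have "\<dots> = (b * (conjugate d * d)) * free_ip X x (word bs)"
    by (simp add: const_left_commute free_ip_const_left free_ip_const_right conjugate_dist_mul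
        free_ip_append_right[OF on])
  finally show ?thesis
    by (simp add: conjugate_mult_self_of_real w(2) free_ip_const_right)
qed

text \<open>
  The key computation.  If \<open>C\<^sup>\<star> = A\<^sup>\<star> \<and> B\<^sup>\<star>\<close>, then
  \<open>\<langle>\<Omega>, A \<and> (C \<lrcorner> B)\<rangle> = \<langle>A\<^sup>\<star>, C \<lrcorner> B\<rangle> = \<langle>C \<and> A\<^sup>\<star>, B\<rangle> = \<langle>C \<and> A\<^sup>\<star> \<and> B\<^sup>\<star>, \<Omega>\<rangle> = \<langle>A\<^sup>\<star> \<and> B\<^sup>\<star>, C\<^sup>\<star>\<rangle>\<close>,
  which is a squared norm.  The four steps are the defining property of the star of \<open>A\<close>, that of the
  contraction, \<open>free_ip_mult_star\<close>, and the defining property of the star of \<open>C\<close>.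
\<close>

lemma orientation_coefficient:
  assumes on: "orthonormal (bs @ bs')" and w: "cls w = cls (const d * word (bs @ bs'))" "norm d = 1"
    and sx: "star X (cls w) (cls x) = cls sx"
    and sy: "star X (cls w) (cls (const b * word bs)) = cls sy"
    and sr: "star X (cls w) (cls r) = cls (sx * sy)"
    and k: "lcontr X (cls r) (cls (const b * word bs)) = cls k"
  shows "free_ip X w (x * k) = free_ip X (sx * sy) (sx * sy)"
proof -
  have sy': "cls sy = cls (const (conjugate b * d) * word bs')"
    using sy star_word[OF on w(1)] by metis
  have "free_ip X w (x * k) = conjugate (free_ip X k sx)"
    by (subst free_ip_conjugate) (simp add: star_spec[OF sx])
  also have "\<dots> = free_ip X (r * sx) (const b * word bs)"
    by (simp add: lcontr_spec[OF k] flip: free_ip_conjugate)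
  also have "\<dots> = free_ip X (r * sx * sy) w"
    by (simp add: free_ip_mult_star[OF on w sy'])
  also have "\<dots> = free_ip X (sx * sy) (sx * sy)"
    by (simp add: star_spec[OF sr] mult.assoc)
  finally show ?thesis .
qed

text \<open>
  \<open>A \<and> (C \<lrcorner> B)\<close> has top degree, hence is a multiple of \<open>\<Omega>\<close>, and it depends on \<open>C\<close>
  conjugate-linearly.  That \<open>z\<close> is the same for all multiples of one blade is what the uniqueness
  argument uses.
\<close>

lemma wedge_contraction_top:
  assumes on: "orthonormal cs" "orthonormal bs" "vs.span (set cs) \<subseteq> vs.span (set bs)"
    and es: "orthonormal es" "vs.span (set es) = UNIV" "\<Omega> = cls (const w * word es)" "w \<noteq> 0"
    and len: "length as + length bs = length es + length cs"
  obtains z where "\<And>c. cls (const a * word as) \<and>\<^bsub>X\<^esub>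
    lcontr X (cls (const c * word cs)) (cls (const b * word bs)) = ext_scl X (conjugate c * z) \<Omega>"
proof -
  obtain fs where fs: "orthonormal (cs @ fs)" "vs.span (set (cs @ fs)) = vs.span (set bs)"
    using orthonormal_extend_to[OF on(1,3)] .
  have lenfs: "length (cs @ fs) = length bs"
    by (rule orthonormal_length_eq[OF fs(1) on(2) fs(2)])
  have "set bs \<subseteq> vs.span (set (cs @ fs))" using fs(2) vs.span_superset by simp
  from word_proportional[OF this lenfs[symmetric]] obtain m
    where m: "cls (word bs) = cls (const m * word (cs @ fs))" .
  have "set (as @ fs) \<subseteq> vs.span (set es)" "length (as @ fs) = length es"
    using es(2) len lenfs by simp_all
  from word_proportional[OF this] obtain t
    where t: "cls (word (as @ fs)) = cls (const t * word es)" .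
  have B: "cls (const b * word bs) = cls (const (b * m) * word (cs @ fs))"
    by (simp only: const_const_mult[symmetric]) (intro cls_mult refl m)
  show ?thesis
  proof (rule that)
    fix c
    have "lcontr X (cls (const c * word cs)) (cls (const b * word bs)) =
        cls (const (conjugate c * (b * m)) * word fs)"
      unfolding B by (rule lcontr_word[OF fs(1)])
    then have "cls (const a * word as) \<and>\<^bsub>X\<^esub>
        lcontr X (cls (const c * word cs)) (cls (const b * word bs)) =
        cls (const (a * (conjugate c * (b * m))) * word (as @ fs))"
      by (simp only: wedge_class word_append const_mult_const_mult)
    also have "\<dots> = cls (const (a * (conjugate c * (b * m))) * (const t * word es))"
      by (intro cls_mult refl t)
    also have "\<dots> = ext_scl X (conjugate c * (a * b * m * t / w)) \<Omega>"
      using es(4) by (simp add: es(3) ext_scl_class const_const_mult mult_ac)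
    finally show "cls (const a * word as) \<and>\<^bsub>X\<^esub>
        lcontr X (cls (const c * word cs)) (cls (const b * word bs)) =
        ext_scl X (conjugate c * (a * b * m * t / w)) \<Omega>" .
  qed
qed

end

theorem theorem4p16:
  fixes X :: "('k::real_or_complex, 'v::ab_group_add) ips"
    and n p q :: nat
    and \<Omega> A B :: "('v tword \<Rightarrow>\<^sub>0 'k) set"
  assumes X: "fin_inner_space X" "ips_dim X = n"
    and orientation: "is_orientation X \<Omega>"
    and A: "is_blade X p A" "A \<noteq> \<zero>\<^bsub>exterior X\<^esub>"
    and B: "is_blade X q B" "B \<noteq> \<zero>\<^bsub>exterior X\<^esub>"
  shows "(regr X \<Omega> A B = \<zero>\<^bsub>exterior X\<^esub> \<longleftrightarrow>
            {a + b | a b. a \<in> blade_space X A \<and> b \<in> blade_space X B} \<noteq> UNIV) \<and>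
         (regr X \<Omega> A B \<noteq> \<zero>\<^bsub>exterior X\<^esub> \<longrightarrow>
            n \<le> p + q \<and>
            (\<forall>C. is_blade X (p + q - n) C \<and>
                 blade_space X C = blade_space X A \<inter> blade_space X B \<and>
                 ext_norm X C = ext_norm X A * ext_norm X B *
                   cos (asym_angle X (perp X (blade_space X A)) (blade_space X B)) \<and>
                 same_orientation X (A \<and>\<^bsub>X\<^esub> lcontr X C B) \<Omega>
               \<longleftrightarrow> C = regr X \<Omega> A B))"
proof -
  interpret fin_inner_space X by (rule X(1))
  obtain as \<alpha> where as: "orthonormal as" "length as = p" "\<alpha> \<noteq> 0"
    and A_eq: "A = cls (const \<alpha> * word as)" and spA: "blade_space X A = vs.span (set as)"
    using nonzero_blade[OF A(1)] A(2) by (metis zero_exterior)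
  obtain bs \<beta> where bs: "orthonormal bs" "length bs = q" "\<beta> \<noteq> 0"
    and B_eq: "B = cls (const \<beta> * word bs)" and spB: "blade_space X B = vs.span (set bs)"
    using nonzero_blade[OF B(1)] B(2) by (metis zero_exterior)
  obtain as' where as': "orthonormal (as @ as')" "vs.span (set (as @ as')) = UNIV"
    using orthonormal_extend_basis[OF as(1)] .
  obtain bs' where bs': "orthonormal (bs @ bs')" "vs.span (set (bs @ bs')) = UNIV"
    using orthonormal_extend_basis[OF bs(1)] .
  obtain \<omega>A where \<omega>A: "norm \<omega>A = 1" "\<Omega> = cls (const \<omega>A * word (as @ as'))"
    using orientation_class[OF orientation as'] .
  obtain \<omega>B where \<omega>B: "norm \<omega>B = 1" "\<Omega> = cls (const \<omega>B * word (bs @ bs'))"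
    using orientation_class[OF orientation bs'] .
  have n: "p + length as' = n" "q + length bs' = n"
    using orthonormal_basis_length[OF as'] orthonormal_basis_length[OF bs'] as(2) bs(2) X(2)
    by simp_all
  define sA where "sA = const (conjugate \<alpha> * \<omega>A) * word as'"
  define sB where "sB = const (conjugate \<beta> * \<omega>B) * word bs'"
  have starA: "star X \<Omega> A = cls sA"
    unfolding A_eq sA_def by (rule star_word[OF as'(1) \<omega>A(2)])
  have starB: "star X \<Omega> B = cls sB"
    unfolding B_eq sB_def by (rule star_word[OF bs'(1) \<omega>B(2)])
  \<comment> \<open>The scalar \<open>\<delta>\<close> collects all factors: \<open>A\<^sup>\<star> \<and> B\<^sup>\<star>\<close> is \<open>\<delta>\<close> times the wedge of the complements.\<close>
  define \<delta> where "\<delta> = conjugate \<alpha> * \<omega>A * (conjugate \<beta> * \<omega>B)"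
  have sAB: "sA * sB = const \<delta> * word (as' @ bs')"
    by (simp only: sA_def sB_def \<delta>_def word_append const_mult_const_mult)
  have norm_\<delta>: "norm \<delta> = norm \<alpha> * norm \<beta>"
    by (simp add: \<delta>_def norm_mult \<omega>A(1) \<omega>B(1))
  have \<delta>0: "\<delta> \<noteq> 0" using norm_\<delta> as(3) bs(3) by auto
  have starAB: "star X \<Omega> A \<and>\<^bsub>X\<^esub> star X \<Omega> B = cls (const \<delta> * word (as' @ bs'))"
    by (simp add: starA starB wedge_class sAB)
  have sum_set: "{a + b | a b. a \<in> blade_space X A \<and> b \<in> blade_space X B} =
      vs.span (set as \<union> set bs)"
    by (auto simp: spA spB vs.span_Un)

  show ?thesis
  proof (cases "vs.span (set as \<union> set bs) = UNIV")
    case False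
    have "cls (const \<delta> * word (as' @ bs')) = cls (const \<delta> * 0)"
      by (intro cls_mult refl complements_wedge_eq_0[OF as' bs' False])
    moreover have "star X \<Omega> (cls 0) = cls 0"
      unfolding \<omega>A(2) star_def by (rule lcontr_eqI) simp
    ultimately have "regr X \<Omega> A B = cls 0"
      by (intro regr_eqI[OF orientation]) (simp add: starAB)
    with False show ?thesis by (simp add: sum_set zero_exterior)
  next
    case True
    have nz: "cls (word (as' @ bs')) \<noteq> cls 0"
      by (rule complements_wedge_nonzero[OF as' bs' True])
    obtain cs \<gamma> where cs: "orthonormal cs" "length cs = length (as' @ bs')" "\<gamma> \<noteq> 0"
      "cls (word (as' @ bs')) = cls (const \<gamma> * word cs)"
      "vs.span (set cs) = vs.span (set (as' @ bs'))"
      using wedge_list_orthonormal[OF nz] .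
    obtain ds where ds: "orthonormal (cs @ ds)" "vs.span (set (cs @ ds)) = UNIV"
      using orthonormal_extend_basis[OF cs(1)] .
    have dc: "orthonormal (ds @ cs)" "vs.span (set (ds @ cs)) = UNIV"
      using ds by (simp_all add: orthonormal_commute[of ds] Un_commute)
    have d: "orthonormal ds" using ds(1) by (simp add: orthonormal_append)
    have int: "vs.span (set ds) = vs.span (set as) \<inter> vs.span (set bs)"
      by (rule perp_span_inter[OF as' bs' ds cs(5)])
    have "length cs + length ds = n"
      using orthonormal_basis_length[OF ds] X(2) by simp
    then have npq: "n \<le> p + q" and lend: "length ds = p + q - n"
      using cs(2) n by simp_all
    obtain \<omega> where \<omega>: "norm \<omega> = 1" "\<Omega> = cls (const \<omega> * word (ds @ cs))"
      using orientation_class[OF orientation dc] .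
    have \<omega>0: "\<omega> \<noteq> 0" using \<omega>(1) by auto
    \<comment> \<open>The value for which the star of \<open>\<kappa>\<close> times \<open>word ds\<close>, namely \<open>conjugate \<kappa> * \<omega>\<close> times \<open>word cs\<close>, is \<open>A\<^sup>\<star> \<and> B\<^sup>\<star>\<close>.\<close>
    define \<kappa> where "\<kappa> = conjugate (\<delta> * \<gamma> / \<omega>)"
    have norm_\<kappa>: "norm \<kappa> = norm \<alpha> * norm \<beta> * norm \<gamma>"
      by (simp add: \<kappa>_def norm_mult norm_divide norm_\<delta> \<omega>(1))
    have \<kappa>0: "\<kappa> \<noteq> 0" using norm_\<kappa> as(3) bs(3) cs(3) by auto
    have sAB': "cls (sA * sB) = cls (const (\<delta> * \<gamma>) * word cs)"
    proof -
      have "cls (sA * sB) = cls (const \<delta> * (const \<gamma> * word cs))"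
        unfolding sAB by (intro cls_mult refl cs(4))
      then show ?thesis by (simp only: const_const_mult)
    qed
    have star\<kappa>: "star X \<Omega> (cls (const \<kappa> * word ds)) = cls (sA * sB)"
      unfolding star_word[OF dc(1) \<omega>(2)] sAB' using \<omega>0 by (simp add: \<kappa>_def)
    have regr: "regr X \<Omega> A B = cls (const \<kappa> * word ds)"
      by (rule regr_eqI[OF orientation]) (simp only: star\<kappa> starA starB wedge_class)
    have regr0: "regr X \<Omega> A B \<noteq> \<zero>\<^bsub>exterior X\<^esub>"
      using const_word_eq_0_iff[OF d] \<kappa>0 by (simp add: regr zero_exterior)

    have a': "orthonormal as'" using as'(1) by (simp add: orthonormal_append)
    have angle: "cos (asym_angle X (perp X (blade_space X A)) (blade_space X B)) = norm \<gamma>"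
      unfolding spA spB perp_span_orthonormal[OF as'] cos_asym_angle[OF a' bs'] cs(4)
      by (simp add: ext_norm_const ext_norm_orthonormal[OF cs(1)])
    have norms: "ext_norm X A * ext_norm X B *
        cos (asym_angle X (perp X (blade_space X A)) (blade_space X B)) = norm \<kappa>"
      unfolding angle norm_\<kappa>
      by (simp add: A_eq B_eq ext_norm_const ext_norm_orthonormal[OF as(1)]
          ext_norm_orthonormal[OF bs(1)])

    obtain z where z: "\<And>c. A \<and>\<^bsub>X\<^esub> lcontr X (cls (const c * word ds)) B =
        ext_scl X (conjugate c * z) \<Omega>"
    proof -
      have "length as + length bs = length (ds @ cs) + length ds"
        using \<open>length cs + length ds = n\<close> as(2) bs(2) npq lend by simp
      moreover have "vs.span (set ds) \<subseteq> vs.span (set bs)" using int by simp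
      ultimately show ?thesis
        using that wedge_contraction_top[OF d bs(1) _ dc \<omega>(2) \<omega>0, of as \<alpha> \<beta>]
        unfolding A_eq B_eq by metis
    qed
    \<comment> \<open>The squared norm of \<open>A\<^sup>\<star> \<and> B\<^sup>\<star>\<close>, which is the coefficient of \<open>\<Omega>\<close> in (iii).\<close>
    define r where "r = (norm (\<delta> * \<gamma>))\<^sup>2"
    have r0: "0 < r" using \<delta>0 cs(3) by (simp add: r_def)
    have \<kappa>z: "conjugate \<kappa> * z = of_real r"
    proof -
      let ?w = "const \<omega> * word (ds @ cs)"
      obtain k where k: "lcontr X (cls (const \<kappa> * word ds)) B = cls k"
        unfolding B_eq using lcontr_obtain by metis
      have "free_ip X ?w ((const \<alpha> * word as) * k) = free_ip X (sA * sB) (sA * sB)"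
        by (rule orientation_coefficient[OF bs'(1) _ \<omega>B(1), where b = \<beta>])
          (use \<omega>(2) \<omega>B(2) starA starB star\<kappa> k in \<open>simp_all add: A_eq B_eq\<close>)
      also have "\<dots> = free_ip X (const (\<delta> * \<gamma>) * word cs) (const (\<delta> * \<gamma>) * word cs)"
        using free_ip_cong_left[OF sAB'] free_ip_cong_right[OF sAB'] by simp
      also have "\<dots> = of_real r"
        by (simp add: free_ip_const_left free_ip_const_right gram_orthonormal[OF cs(1)] r_def
            mult_conjugate_self_of_real)
      finally have 1: "free_ip X ?w ((const \<alpha> * word as) * k) = of_real r" .
      have "cls ((const \<alpha> * word as) * k) = cls (const (conjugate \<kappa> * z) * ?w)"
        using z[of \<kappa>] k by (simp add: A_eq wedge_class \<omega>(2) ext_scl_class)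
      then have "of_real r = free_ip X ?w (const (conjugate \<kappa> * z) * ?w)"
        unfolding 1[symmetric] by (rule free_ip_cong_right)
      also have "\<dots> = (conjugate \<kappa> * z) * (conjugate \<omega> * \<omega>)"
        by (simp add: free_ip_const_left free_ip_const_right gram_orthonormal[OF dc(1)] mult_ac)
      finally have "of_real r = (conjugate \<kappa> * z) * (conjugate \<omega> * \<omega>)" .
      then show ?thesis by (simp add: conjugate_mult_self_of_real \<omega>(1))
    qed
    have z0: "z \<noteq> 0" using \<kappa>z r0 by auto
    have \<Omega>0: "\<Omega> \<noteq> \<zero>\<^bsub>exterior X\<^esub>"
      using const_word_eq_0_iff[OF dc(1)] \<omega>0 by (simp add: \<omega>(2) zero_exterior)
    have scl\<Omega>: "ext_scl X t \<Omega> = ext_scl X t' \<Omega> \<longleftrightarrow> t = t'" for t t'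
      using const_word_cancel[OF dc(1), of "t * \<omega>" "t' * \<omega>"] \<omega>0
      by (auto simp: \<omega>(2) ext_scl_class const_const_mult)
    have orient: "same_orientation X (A \<and>\<^bsub>X\<^esub> lcontr X (cls (const c * word ds)) B) \<Omega> \<longleftrightarrow>
        (\<exists>s>0. conjugate c * z = of_real s)" for c
    proof -
      have "\<zero>\<^bsub>exterior X\<^esub> = ext_scl X 0 \<Omega>"
        by (simp add: \<omega>(2) ext_scl_class zero_exterior)
      then have "ext_scl X (of_real s) \<Omega> \<noteq> \<zero>\<^bsub>exterior X\<^esub>" if "0 < s" for s
        using that by (simp add: scl\<Omega>)
      then show ?thesis using \<Omega>0 unfolding z same_orientation_def scl\<Omega> by metis
    qed

    have "(is_blade X (p + q - n) C \<and>
        blade_space X C = blade_space X A \<inter> blade_space X B \<and>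
        ext_norm X C = ext_norm X A * ext_norm X B *
          cos (asym_angle X (perp X (blade_space X A)) (blade_space X B)) \<and>
        same_orientation X (A \<and>\<^bsub>X\<^esub> lcontr X C B) \<Omega>) \<longleftrightarrow> C = regr X \<Omega> A B" for C
      unfolding norms
    proof (intro iffI conjI; (elim conjE)?)
      assume C: "C = regr X \<Omega> A B"
      show "is_blade X (p + q - n) C"
        unfolding C regr lend[symmetric] by (rule is_blade_word)
      show "blade_space X C = blade_space X A \<inter> blade_space X B"
        unfolding C regr blade_space_word[OF d \<kappa>0] spA spB by (rule int)
      show "ext_norm X C = norm \<kappa>"
        by (simp add: C regr ext_norm_const ext_norm_orthonormal[OF d])
      show "same_orientation X (A \<and>\<^bsub>X\<^esub> lcontr X C B) \<Omega>"
        unfolding C regr orient using r0 \<kappa>z by blast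
    next
      assume blade: "is_blade X (p + q - n) C"
        and space: "blade_space X C = blade_space X A \<inter> blade_space X B"
        and nrm: "ext_norm X C = norm \<kappa>"
        and ori: "same_orientation X (A \<and>\<^bsub>X\<^esub> lcontr X C B) \<Omega>"
      \<comment> \<open>A blade with the right space is a multiple \<open>c\<close> of \<open>word ds\<close>; (ii) fixes the modulus of \<open>c\<close> and (iii) its phase.\<close>
      have "C \<noteq> cls 0" using nrm \<kappa>0 by (auto simp: ext_norm_class)
      from nonzero_blade[OF blade this] obtain es e where es: "orthonormal es"
        "length es = p + q - n" "C = cls (const e * word es)" "vs.span (set es) = vs.span (set ds)"
        using space spA spB int by metis
      have "set es \<subseteq> vs.span (set ds)" using es(4) vs.span_superset by blast
      from word_proportional[OF this] obtain m where m: "cls (word es) = cls (const m * word ds)"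
        using es(2) lend by metis
      have "C = cls (const e * (const m * word ds))"
        unfolding es(3) by (intro cls_mult refl m)
      then have C: "C = cls (const (e * m) * word ds)"
        by (simp only: const_const_mult)
      define c where "c = e * m"
      obtain s where s: "0 < s" "conjugate c * z = of_real s"
        using ori unfolding C orient c_def by blast
      have "norm c = norm \<kappa>"
        using nrm by (simp add: C c_def ext_norm_const ext_norm_orthonormal[OF d])
      then have "norm (conjugate c * z) = norm (conjugate \<kappa> * z)"
        by (simp add: norm_mult)
      then have "s = r" unfolding s(2) \<kappa>z using s(1) r0 by simp
      then have "conjugate c * z = conjugate \<kappa> * z" using s(2) \<kappa>z by simp
      then have "c = \<kappa>" using z0 by simp
      then show "C = regr X \<Omega> A B" by (simp add: C regr flip: c_def)
    qed
    with True npq regr0 show ?thesis by (simp add: sum_set)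
  qed
qed

end
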